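(* Let $\alpha\in(0,2)$ and let $\varepsilon_t$, $\gamma_{n,\varepsilon}$, $\rho_{n,\varepsilon}$, $Y_0,Y_1,\dots$, $\ell^{\alpha}\log\ell$, $X_n(\mathbf a)$, $\widetilde X_n(\mathbf a)$, $Y(\mathbf a)$, $\widetilde Y(\mathbf a)$ be as in the context. Then the finite-dimensional distributions converge: $$(X_n(\mathbf a))_{\mathbf a\in\ell^{\alpha}\log\ell}\xrightarrow{\text{fidi}}(Y(\mathbf a))_{\mathbf a\in\ell^{\alpha}\log\ell},\qquad (\widetilde X_n(\mathbf a))_{\mathbf a\in\ell^{\alpha}\log\ell}\xrightarrow{\text{fidi}}(\widetilde Y(\mathbf a))_{\mathbf a\in\ell^{\alpha}\log\ell},$$ i.e. for every finite collection $\mathbf a^{(1)},\dots,\mathbf a^{(r)}\in\ell^\alpha\log\ell$, $(X_n(\mathbf a^{(1)}),\dots,X_n(\mathbf a^{(r)}))$ converges in distribution to $(Y(\mathbf a^{(1)}),\dots,Y(\mathbf a^{(r)}))$ as $n\to\infty$, and similarly for $\widetilde X_n,\widetilde Y$.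
   Context: Let $(\varepsilon_t)_{t\in\mathbb Z}$ be i.i.d. symmetric $\alpha$-stable random variables with $E e^{\mathrm i u\varepsilon_1}=e^{-|u|^\alpha}$, $\alpha\in(0,2)$. For $n\ge1$ and $0\le h\le n-1$ put $\gamma_{n,\varepsilon}(h)=\frac1n\sum_{t=1}^{n-h}\varepsilon_t\varepsilon_{t+h}$ and $\rho_{n,\varepsilon}(h)=\gamma_{n,\varepsilon}(h)/\gamma_{n,\varepsilon}(0)$. Let $Y_0,Y_1,Y_2,\dots$ be independent random variables with $Y_0\sim S_{\alpha/2}(\sigma_1,1,0)$ and $Y_1,Y_2,\dots$ i.i.d. $S_\alpha(\sigma_2,0,0)$ (stable laws in the notation $S_\alpha(\sigma,\beta,\mu)$ of Samorodnitsky–Taqqu), where $\sigma_1,\sigma_2>0$ depend only on $\alpha$ and are the constants for which, for every $m\ge1$, $\big(n\gamma_{n,\varepsilon}(0)/n^{2/\alpha},\ n\gamma_{n,\varepsilon}(h)/(n\log n)^{1/\alpha},\ h=1,\dots,m\big)$ converges in distribution to $(Y_0,Y_1,\dots,Y_m)$. Let $\ell^{\alpha}\log\ell$ be the set of real sequences $\mathbf a=(a_1,a_2,\dots)$ with $\sum_k|a_k|^\alpha<\infty$ and $\sum_k|a_k|^\alpha\log^+(1/|a_k|)<\infty$ (terms with $a_k=0$ are $0$). For $\mathbf a\in\ell^\alpha\log\ell$ define $X_n(\mathbf a)=(n\log n)^{-1/\alpha}\sum_{k=1}^{n-1}a_k\,[n\gamma_{n,\varepsilon}(k)]$, $\widetilde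 X_n(\mathbf a)=(n/\log n)^{1/\alpha}\sum_{k=1}^{n-1}a_k\rho_{n,\varepsilon}(k)$, $Y(\mathbf a)=\sum_{k=1}^\infty a_kY_k$ (an a.s. convergent series) and $\widetilde Y(\mathbf a)=Y(\mathbf a)/Y_0$. *)

theory Defs
  imports "HOL-Probability.Probability"
begin

text \<open>Characteristic function of the stable law S_alpha(sigma, beta, mu)
  in the parametrisation of Samorodnitsky--Taqqu.\<close>
definition stable_charfun :: "real \<Rightarrow> real \<Rightarrow> real \<Rightarrow> real \<Rightarrow> real \<Rightarrow> complex" where
  "stable_charfun a \<sigma> \<beta> \<mu> t =
     (if a \<noteq> 1 then
        exp (- complex_of_real ((\<sigma> powr a) * (\<bar>t\<bar> powr a))
               * (1 - \<i> * complex_of_real (\<beta> * sgn t * tan (pi * a / 2)))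
             + \<i> * complex_of_real (\<mu> * t))
      else
        exp (- complex_of_real (\<sigma> * \<bar>t\<bar>)
               * (1 + \<i> * complex_of_real (\<beta> * (2 / pi) * sgn t * ln \<bar>t\<bar>))
             + \<i> * complex_of_real (\<mu> * t)))"

definition has_stable_law ::
  "'w measure \<Rightarrow> ('w \<Rightarrow> real) \<Rightarrow> real \<Rightarrow> real \<Rightarrow> real \<Rightarrow> real \<Rightarrow> bool" where
  "has_stable_law M X a \<sigma> \<beta> \<mu> \<longleftrightarrow>
     X \<in> borel_measurable M \<and> (\<forall>t. char (distr M borel X) t = stable_charfun a \<sigma> \<beta> \<mu> t)"

definition conv_distr ::
  "'w measure \<Rightarrow> (nat \<Rightarrow> 'w \<Rightarrow> 'b::topological_space) \<Rightarrow> ('w \<Rightarrow> 'b) \<Rightarrow> bool" where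
  "conv_distr M X Y \<longleftrightarrow>
     (\<forall>f :: 'b \<Rightarrow> real. continuous_on UNIV f \<longrightarrow> bounded (range f) \<longrightarrow>
        (\<lambda>n. integral\<^sup>L M (\<lambda>\<omega>. f (X n \<omega>))) \<longlonglongrightarrow> integral\<^sup>L M (\<lambda>\<omega>. f (Y \<omega>)))"

definition gamma_n :: "(int \<Rightarrow> 'w \<Rightarrow> real) \<Rightarrow> nat \<Rightarrow> nat \<Rightarrow> 'w \<Rightarrow> real" where
  "gamma_n eps n h \<omega> = (1 / real n) * (\<Sum>t\<in>{1..int n - int h}. eps t \<omega> * eps (t + int h) \<omega>)"

definition rho_n :: "(int \<Rightarrow> 'w \<Rightarrow> real) \<Rightarrow> nat \<Rightarrow> nat \<Rightarrow> 'w \<Rightarrow> real" where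
  "rho_n eps n h \<omega> = gamma_n eps n h \<omega> / gamma_n eps n 0 \<omega>"

text \<open>The sequence space l^alpha log l; a sequence (a_1, a_2, ...) is a function
  nat \<Rightarrow> real whose value at 0 is irrelevant.\<close>
definition ell_alpha_log :: "real \<Rightarrow> (nat \<Rightarrow> real) set" where
  "ell_alpha_log \<alpha> = {a. summable (\<lambda>k. \<bar>a (Suc k)\<bar> powr \<alpha>) \<and>
      summable (\<lambda>k. if a (Suc k) = 0 then 0
                     else \<bar>a (Suc k)\<bar> powr \<alpha> * max 0 (ln (1 / \<bar>a (Suc k)\<bar>)))}"

definition X_n :: "real \<Rightarrow> (int \<Rightarrow> 'w \<Rightarrow> real) \<Rightarrow> nat \<Rightarrow> (nat \<Rightarrow> real) \<Rightarrow> 'w \<Rightarrow> real" where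
  "X_n \<alpha> eps n a \<omega> = (real n * ln (real n)) powr (- 1 / \<alpha>) *
      (\<Sum>k\<in>{1..n-1}. a k * (real n * gamma_n eps n k \<omega>))"

definition Xt_n :: "real \<Rightarrow> (int \<Rightarrow> 'w \<Rightarrow> real) \<Rightarrow> nat \<Rightarrow> (nat \<Rightarrow> real) \<Rightarrow> 'w \<Rightarrow> real" where
  "Xt_n \<alpha> eps n a \<omega> = (real n / ln (real n)) powr (1 / \<alpha>) *
      (\<Sum>k\<in>{1..n-1}. a k * rho_n eps n k \<omega>)"

text \<open>Y(a) = sum_{k>=1} a_k Y_k (the series converges a.s.).\<close>
definition Y_of :: "(nat \<Rightarrow> 'w \<Rightarrow> real) \<Rightarrow> (nat \<Rightarrow> real) \<Rightarrow> 'w \<Rightarrow> real" where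
  "Y_of Y a \<omega> = (\<Sum>k. a (Suc k) * Y (Suc k) \<omega>)"

definition Yt_of :: "(nat \<Rightarrow> 'w \<Rightarrow> real) \<Rightarrow> (nat \<Rightarrow> real) \<Rightarrow> 'w \<Rightarrow> real" where
  "Yt_of Y a \<omega> = Y_of Y a \<omega> / Y 0 \<omega>"

end

theory Submission
  imports Defs
begin

text \<open>
  The hypothesis gives the convergence of the sums truncated at lag \<open>m\<close>, and
  \<open>\<Sum>a\<^sub>k Y\<^sub>k\<close> converges almost surely by Ottaviani's inequality, so the point is that the lags
  \<open>k > m\<close> contribute little, uniformly in \<open>n\<close>. Their contribution is an off-diagonal quadratic form
  in the \<open>\<epsilon>\<^sub>t\<close>. No decoupling is needed: after truncating each summand \<open>b \<epsilon>\<^sub>s \<epsilon>\<^sub>t\<close> by an odd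
  function the summands are uncorrelated by symmetry, so the form is controlled in probability by
  \<open>\<Sum> E min(1, (b \<epsilon>\<^sub>s \<epsilon>\<^sub>t)\<^sup>2)\<close>. Each term is at most a constant times
  \<open>\<bar>b\<bar>\<^sup>\<alpha> (1 + log\<^sup>+ (1 / \<bar>b\<bar>))\<close>, and with \<open>b = a\<^sub>k (n log n) powr (- 1 / \<alpha>)\<close> the sum over the at most
  \<open>n\<close> pairs of each lag is bounded by the tail of the series defining \<open>\<ell>\<^sup>\<alpha> log \<ell>\<close>. The normalised
  statement follows because the first coordinate \<open>Y\<^sub>0\<close> of the joint limit has no atom at \<open>0\<close>.
\<close>

subsection \<open>Truncated moments\<close>

text \<open>The obstacle is that for \<alpha> < 2 the variables have neither a second nor an
  \<alpha>-th absolute moment. Every moment estimate therefore goes through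
  \<open>min 1 (x\<^sup>2)\<close>, whose expectation is controlled by a bound
  \<open>1 - Re (char t) \<le> \<kappa> * \<bar>t\<bar> powr \<alpha>\<close>, without densities or
  tail asymptotics of stable laws. The logarithm arises because conditioning on one factor of a
  product leaves a truncated \<alpha>-th moment of the other, which grows like log (1/b). With
  b^\<alpha> = |a|^\<alpha> / (n log n), the n pairs of one lag cost n b^\<alpha> (1 + log^+ (1/b)),
  where log (1/b) is log (1/|a|) plus at most (2/\<alpha>) log n. The factor log n cancels against
  the normaliser, and what remains is the weight of the sequence space. Random vectors of any length
  are coded as sequences padded with 0, so that weak convergence takes place in the single metric
  space \<open>nat \<Rightarrow> real\<close>. Both assertions are read off one joint convergence
  that keeps the denominator as coordinate 0.\<close>

lemma square_le_one_minus_cos: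
  fixes z :: real
  assumes "\<bar>z\<bar> \<le> 1"
  shows "z\<^sup>2 \<le> 5 / 2 * (1 - cos z)"
proof -
  \<comment> \<open>The half-angle formula 1 - cos z = 2 sin^2 (z/2) reduces the claim to a lower
    bound for the sine. On [0, 1/2] the error x^3/6 is at most x/24, so sin x \<ge> 23x/24, which
    gives the constant 2 * 576/529 < 5/2.\<close>
  define x where "x = \<bar>z\<bar> / 2"
  have x: "0 \<le> x" "x \<le> 1 / 2" using assms by (auto simp: x_def)
  have "\<bar>sin x - (\<Sum>m<3. sin_coeff m * x ^ m)\<bar> \<le> inverse (fact 3) * \<bar>x\<bar> ^ 3"
    by (rule Maclaurin_sin_bound)
  then have "\<bar>sin x - x\<bar> \<le> x ^ 3 / 6"
    using x by (simp add: sin_coeff_def eval_nat_numeral divide_simps)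
  moreover have "x ^ 3 \<le> x / 4"
  proof -
    have "x * x \<le> (1/2) * (1/2)" using x by (intro mult_mono) auto
    then have "x * (x * x) \<le> x * (1/4)" using x by (intro mult_left_mono) auto
    then show ?thesis by (simp add: eval_nat_numeral)
  qed
  ultimately have "23 / 24 * x \<le> sin x" by linarith
  then have "(23 / 24 * x)\<^sup>2 \<le> (sin x)\<^sup>2" using x by (intro power_mono) auto
  then have "529 / 576 * x\<^sup>2 \<le> (sin x)\<^sup>2" by (simp add: power_mult_distrib power_divide)
  moreover have "cos z = 1 - 2 * (sin x)\<^sup>2"
    using cos_double_sin[of x] by (simp add: x_def)
  moreover have "z\<^sup>2 = 4 * x\<^sup>2" by (simp add: x_def power_divide)
  moreover have "0 \<le> (sin x)\<^sup>2" by simp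
  moreover have "v \<le> 5 / 2 * (1 - c)"
    if "529 / 576 * u \<le> s" "c = 1 - 2 * s" "v = 4 * u" "0 \<le> s" for u v s c :: real
    using that by simp
  ultimately show ?thesis by blast
qed

text \<open>Halving y until it first lies in [-1, 1] leaves a value of modulus at least 1/2, where
  the quadratic bound gives 1 \<le> 4 z^2 \<le> 10 (1 - cos z). The number of halvings depends on y;
  summing over all \<open>j\<close> later removes this dependence.\<close>

lemma min_one_square_le_one_minus_cos:
  fixes y :: real
  shows "\<exists>j. min 1 (y\<^sup>2) \<le> 10 * (1 - cos (y / 2 ^ j))"
proof (cases "\<bar>y\<bar> \<le> 1")
  case True
  have "y\<^sup>2 \<le> 10 * (1 - cos y)"
    using square_le_one_minus_cos[OF True]
    by (rule order_trans) (intro mult_right_mono, auto)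
  then have "min 1 (y\<^sup>2) \<le> 10 * (1 - cos (y / 2 ^ 0))"
    unfolding min_le_iff_disj by simp
  then show ?thesis by blast
next
  case False
  obtain j where j: "\<bar>y\<bar> < 2 ^ j" using real_arch_pow[of 2 "\<bar>y\<bar>"] by auto
  define k where "k = (LEAST k. \<bar>y\<bar> \<le> 2 ^ k)"
  have k: "\<bar>y\<bar> \<le> 2 ^ k" unfolding k_def by (rule LeastI[of _ j]) (use j in auto)
  have "k \<noteq> 0" using k False by (auto intro!: Nat.gr0I)
  then obtain l where l: "k = Suc l" by (cases k) auto
  have "\<not> \<bar>y\<bar> \<le> 2 ^ l" using not_less_Least[of l "\<lambda>k. \<bar>y\<bar> \<le> 2 ^ k"] l by (simp add: k_def)
  then have "1 / 2 \<le> \<bar>y / 2 ^ k\<bar>" by (simp add: l field_simps)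
  moreover have 1: "\<bar>y / 2 ^ k\<bar> \<le> 1" using k by simp
  ultimately have "(1/2)\<^sup>2 \<le> (\<bar>y / 2 ^ k\<bar>)\<^sup>2" by (intro power_mono) auto
  then have "1 \<le> 4 * (y / 2 ^ k)\<^sup>2" by (simp add: power2_eq_square)
  with square_le_one_minus_cos[OF 1] have "1 \<le> 10 * (1 - cos (y / 2 ^ k))" by simp
  then have "min 1 (y\<^sup>2) \<le> 10 * (1 - cos (y / 2 ^ k))" by (simp add: min_def)
  then show ?thesis by blast
qed

lemma (in prob_space) integral_one_minus_cos:
  assumes [measurable]: "X \<in> borel_measurable M"
  shows "(\<integral>\<omega>. 1 - cos (t * X \<omega>) \<partial>M) = 1 - Re (char (distr M borel X) t)"
proof -
  have int: "integrable M (\<lambda>\<omega>. iexp (t * X \<omega>))"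
    using integrable_iexp[of "\<lambda>\<omega>. of_real (t * X \<omega>)"] by simp
  have "Re (char (distr M borel X) t) = (\<integral>\<omega>. Re (iexp (t * X \<omega>)) \<partial>M)"
    using int by (subst integral_Re) (auto simp: char_def integral_distr)
  also have "\<dots> = (\<integral>\<omega>. cos (t * X \<omega>) \<partial>M)" by (simp add: exp_eq_polar mult.commute Re_exp)
  finally show ?thesis
    by (subst Bochner_Integration.integral_diff)
       (auto simp: prob_space intro!: integrable_const_bound[where B=1])
qed

text \<open>The factor 10 of the pointwise cosine bound times the geometric series of ratio
  2^(-\<alpha>).\<close>

definition moment_const :: "real \<Rightarrow> real" where
  "moment_const \<alpha> = 10 / (1 - 2 powr - \<alpha>)"

lemma moment_const_nonneg: "0 < \<alpha> \<Longrightarrow> 0 \<le> moment_const \<alpha>"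
  by (auto simp: moment_const_def powr_minus intro!: divide_nonneg_nonneg)
     (metis inverse_le_1_iff ge_one_powr_ge_zero less_eq_real_def one_le_numeral)

text \<open>The cosine terms are nonnegative, so the one \<open>j\<close> that works at a given
  point may be replaced by the sum over all \<open>j\<close>. Taking expectations turns the j-th
  term into 10 (1 - Re char (2^(-j))), and the hypothesis makes these terms geometric.\<close>

lemma (in prob_space) expectation_min_one_square_le:
  assumes [measurable]: "X \<in> borel_measurable M" and "0 < \<alpha>" and "0 \<le> \<kappa>"
    and char: "\<And>t. 1 - Re (char (distr M borel X) t) \<le> \<kappa> * \<bar>t\<bar> powr \<alpha>"
  shows "(\<integral>\<omega>. min 1 ((X \<omega>)\<^sup>2) \<partial>M) \<le> moment_const \<alpha> * \<kappa>"
proof -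
  have pw: "ennreal (min 1 ((X \<omega>)\<^sup>2)) \<le> (\<Sum>j. ennreal (10 * (1 - cos ((1 / 2 ^ j) * X \<omega>))))" for \<omega>
  proof -
    obtain j where "min 1 ((X \<omega>)\<^sup>2) \<le> 10 * (1 - cos (X \<omega> / 2 ^ j))"
      using min_one_square_le_one_minus_cos by blast
    then have "ennreal (min 1 ((X \<omega>)\<^sup>2)) \<le> (\<Sum>j\<in>{j}. ennreal (10 * (1 - cos ((1 / 2 ^ j) * X \<omega>))))"
      by (auto intro!: ennreal_leI)
    also have "\<dots> \<le> (\<Sum>j. ennreal (10 * (1 - cos ((1 / 2 ^ j) * X \<omega>))))"
      by (rule sum_le_suminf) auto
    finally show ?thesis .
  qed
  have q: "0 \<le> (2::real) powr - \<alpha>" "(2::real) powr - \<alpha> < 1"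
    using \<open>0 < \<alpha>\<close> by (auto simp: powr_less_one)
  have bnd: "(\<integral>\<^sup>+\<omega>. ennreal (10 * (1 - cos ((1 / 2 ^ j) * X \<omega>))) \<partial>M)
      \<le> ennreal (10 * \<kappa> * (2 powr - \<alpha>) ^ j)" for j
  proof -
    have "(\<integral>\<^sup>+\<omega>. ennreal (10 * (1 - cos ((1 / 2 ^ j) * X \<omega>))) \<partial>M)
        = ennreal (\<integral>\<omega>. 10 * (1 - cos ((1 / 2 ^ j) * X \<omega>)) \<partial>M)"
    proof (rule nn_integral_eq_integral)
      have b: "norm (10 * (1 - cos ((1 / 2 ^ j) * X \<omega>))) \<le> 20" for \<omega>
      proof -
        have *: "\<bar>10 * (1 - c)\<bar> \<le> 20" if "- 1 \<le> c" "c \<le> 1" for c :: real using that by simp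
        show ?thesis unfolding real_norm_def by (rule *) auto
      qed
      show "integrable M (\<lambda>\<omega>. 10 * (1 - cos ((1 / 2 ^ j) * X \<omega>)))"
        by (rule integrable_const_bound[where B=20]) (use b in auto)
    qed auto
    also have "\<dots> = ennreal (10 * (1 - Re (char (distr M borel X) (1 / 2 ^ j))))"
      by (subst integral_mult_right_zero) (simp only: integral_one_minus_cos[OF assms(1)])
    also have "\<dots> \<le> ennreal (10 * (\<kappa> * \<bar>1 / 2 ^ j\<bar> powr \<alpha>))"
      by (intro ennreal_leI mult_left_mono char) auto
    also have "\<bar>1 / 2 ^ j\<bar> powr \<alpha> = (2 powr - \<alpha>) ^ j"
      by (simp add: powr_divide powr_minus divide_simps flip: powr_realpow)
         (simp add: powr_powr mult.commute)
    finally show ?thesis by (simp add: mult.assoc)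
  qed
  have "ennreal (\<integral>\<omega>. min 1 ((X \<omega>)\<^sup>2) \<partial>M) = (\<integral>\<^sup>+\<omega>. ennreal (min 1 ((X \<omega>)\<^sup>2)) \<partial>M)"
    by (rule nn_integral_eq_integral[symmetric])
       (auto intro!: integrable_const_bound[where B=1])
  also have "\<dots> \<le> (\<integral>\<^sup>+\<omega>. (\<Sum>j. ennreal (10 * (1 - cos ((1 / 2 ^ j) * X \<omega>)))) \<partial>M)"
    by (intro nn_integral_mono pw)
  also have "\<dots> = (\<Sum>j. \<integral>\<^sup>+\<omega>. ennreal (10 * (1 - cos ((1 / 2 ^ j) * X \<omega>))) \<partial>M)"
    by (rule nn_integral_suminf) auto
  also have "\<dots> \<le> (\<Sum>j. ennreal (10 * \<kappa> * (2 powr - \<alpha>) ^ j))"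
    by (intro suminf_le bnd) auto
  also have "\<dots> = ennreal (\<Sum>j. 10 * \<kappa> * (2 powr - \<alpha>) ^ j)"
    using q \<open>0 \<le> \<kappa>\<close> by (intro suminf_ennreal2) (auto intro!: summable_mult summable_geometric)
  also have "(\<Sum>j. 10 * \<kappa> * (2 powr - \<alpha>) ^ j) = moment_const \<alpha> * \<kappa>"
    using q by (simp add: suminf_mult suminf_geometric moment_const_def)
  finally show ?thesis
    using \<open>0 \<le> \<kappa>\<close> moment_const_nonneg[OF \<open>0 < \<alpha>\<close>] by (simp add: ennreal_le_iff)
qed

text \<open>The inequality 1 - exp (-x) \<le> x supplies the bound near 0. The parameter \<kappa>
  lets the same estimate serve for a single \<epsilon>_t and for a finite sum of the a_k Y_k, which
  is again symmetric stable.\<close>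

lemma (in prob_space) expectation_min_one_square_scaled_le:
  assumes [measurable]: "X \<in> borel_measurable M" and "0 < \<alpha>" and "0 \<le> \<kappa>"
    and char: "\<And>t. char (distr M borel X) t = exp (- complex_of_real (\<kappa> * \<bar>t\<bar> powr \<alpha>))"
  shows "(\<integral>\<omega>. min 1 ((c * X \<omega>)\<^sup>2) \<partial>M) \<le> moment_const \<alpha> * (\<kappa> * \<bar>c\<bar> powr \<alpha>)"
proof (rule expectation_min_one_square_le)
  fix t
  have "char (distr M borel (\<lambda>\<omega>. c * X \<omega>)) t = char (distr M borel X) (t * c)"
    by (simp add: char_def integral_distr mult.assoc)
  then have "Re (char (distr M borel (\<lambda>\<omega>. c * X \<omega>)) t) = exp (- (\<kappa> * \<bar>t * c\<bar> powr \<alpha>))"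
    by (simp add: char Re_exp)
  moreover have "1 + - (\<kappa> * \<bar>t * c\<bar> powr \<alpha>) \<le> exp (- (\<kappa> * \<bar>t * c\<bar> powr \<alpha>))"
    by (rule exp_ge_add_one_self)
  ultimately show "1 - Re (char (distr M borel (\<lambda>\<omega>. c * X \<omega>)) t) \<le> (\<kappa> * \<bar>c\<bar> powr \<alpha>) * \<bar>t\<bar> powr \<alpha>"
    by (simp add: abs_mult powr_mult mult_ac)
qed (use assms in auto)

section \<open>Truncated \<alpha>-th moments and products of two stable variables\<close>

text \<open>The sum runs over the dyadic levels \<open>2 ^ j\<close> of \<open>\<bar>x\<bar>\<close> below \<open>1 / b\<close>; their number
  produces the logarithm.\<close>

lemma min_one_powr_le_dyadic_sum:
  fixes b x \<alpha> :: real
  assumes "0 < \<alpha>" "0 < b" "1 / b < 2 ^ Suc J"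
  shows "min 1 ((b * \<bar>x\<bar>) powr \<alpha>)
    \<le> b powr \<alpha> + 2 powr \<alpha> * (\<Sum>j\<le>J. (b * 2 ^ j) powr \<alpha> * min 1 (((1 / 2 ^ j) * x)\<^sup>2))"
proof (cases "\<bar>x\<bar> \<le> 1")
  case True
  have "min 1 ((b * \<bar>x\<bar>) powr \<alpha>) \<le> (b * \<bar>x\<bar>) powr \<alpha>" by simp
  also have "\<dots> \<le> b powr \<alpha>"
    using True assms by (intro powr_mono2) (auto intro: mult_left_le)
  also have "\<dots> \<le> b powr \<alpha> + 2 powr \<alpha> * (\<Sum>j\<le>J. (b * 2 ^ j) powr \<alpha> * min 1 (((1 / 2 ^ j) * x)\<^sup>2))"
    by (auto intro!: mult_nonneg_nonneg sum_nonneg)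
  finally show ?thesis .
next
  case False
  \<comment> \<open>Here j is the dyadic level of |x|, capped at J. At this level the truncated
    square equals 1, so a single term of the sum already dominates the left side.\<close>
  have "\<exists>j\<le>J. 1 \<le> \<bar>x\<bar> / 2 ^ j \<and> (\<bar>x\<bar> < 2 ^ Suc j \<or> j = J)"
  proof (cases "2 ^ J \<le> \<bar>x\<bar>")
    case True
    then show ?thesis by (intro exI[of _ J]) (auto simp: field_simps)
  next
    case 1: False
    define k where "k = (LEAST k. \<bar>x\<bar> < 2 ^ k)"
    have k: "\<bar>x\<bar> < 2 ^ k" unfolding k_def by (rule LeastI[of _ J]) (use 1 in auto)
    have "k \<le> J" unfolding k_def by (rule Least_le) (use 1 in auto)
    have "k \<noteq> 0" using k False by (auto intro!: Nat.gr0I)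
    then obtain l where l: "k = Suc l" by (cases k) auto
    have "\<not> \<bar>x\<bar> < 2 ^ l" using not_less_Least[of l "\<lambda>k. \<bar>x\<bar> < 2 ^ k"] l by (simp add: k_def)
    then show ?thesis using k l \<open>k \<le> J\<close> by (intro exI[of _ l]) (auto simp: field_simps)
  qed
  then obtain j where j: "j \<le> J" "1 \<le> \<bar>x\<bar> / 2 ^ j" "\<bar>x\<bar> < 2 ^ Suc j \<or> j = J" by blast
  have m1: "min 1 (((1 / 2 ^ j) * x)\<^sup>2) = 1"
    using power_mono[OF j(2), of 2] by (simp add: min_def power_divide)
  have "min 1 ((b * \<bar>x\<bar>) powr \<alpha>) \<le> (2 * (b * 2 ^ j)) powr \<alpha>"
  proof (cases "\<bar>x\<bar> < 2 ^ Suc j")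
    case True
    have "min 1 ((b * \<bar>x\<bar>) powr \<alpha>) \<le> (b * \<bar>x\<bar>) powr \<alpha>" by simp
    also have "\<dots> \<le> (2 * (b * 2 ^ j)) powr \<alpha>" using True assms by (intro powr_mono2) auto
    finally show ?thesis .
  next
    case False
    \<comment> \<open>The cap is active, so j = J, and 1/b < 2^(J+1) says that 2 b 2^J exceeds 1,
      the largest value the left side can take.\<close>
    then have "1 \<le> 2 * (b * 2 ^ j)" using assms j by (auto simp: field_simps)
    then have "1 \<le> (2 * (b * 2 ^ j)) powr \<alpha>" using assms by (intro ge_one_powr_ge_zero) auto
    then show ?thesis by linarith
  qed
  also have "\<dots> = 2 powr \<alpha> * (\<Sum>i\<in>{j}. (b * 2 ^ i) powr \<alpha> * min 1 (((1 / 2 ^ i) * x)\<^sup>2))"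
    using assms by (simp only: sum.insert finite.emptyI empty_iff not_False_eq_True sum.empty m1)
       (simp add: powr_mult)
  also have "\<dots> \<le> 2 powr \<alpha> * (\<Sum>j\<le>J. (b * 2 ^ j) powr \<alpha> * min 1 (((1 / 2 ^ j) * x)\<^sup>2))"
    using j by (intro mult_left_mono sum_mono2) auto
  also have "\<dots> \<le> b powr \<alpha> + \<dots>" by simp
  finally show ?thesis .
qed

text \<open>The 1 comes from the values |x| \<le> 1, the factor 2^\<alpha> from rounding |x| to a
  dyadic level, and the factor 2 from counting levels by natural logarithms.\<close>

definition log_moment_const :: "real \<Rightarrow> real" where
  "log_moment_const \<alpha> = 1 + 2 * 2 powr \<alpha> * moment_const \<alpha>"

lemma log_moment_const_ge_1: "0 < \<alpha> \<Longrightarrow> 1 \<le> log_moment_const \<alpha>"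
  by (auto simp: log_moment_const_def intro!: mult_nonneg_nonneg moment_const_nonneg)

text \<open>The weight (b 2^j)^\<alpha> cancels the decay 2^(-j \<alpha>) of the truncated second
  moment of X / 2^j, so every dyadic level below 1/b contributes the same multiple of b^\<alpha>.
  There are about log (1/b) levels. For b > 1 the right side is at least 1 and nothing is to be
  shown.\<close>

lemma (in prob_space) expectation_min_one_powr_le:
  assumes [measurable]: "X \<in> borel_measurable M" and "0 < \<alpha>" and "0 < b"
    and char: "\<And>t. char (distr M borel X) t = exp (- complex_of_real (\<bar>t\<bar> powr \<alpha>))"
  shows "(\<integral>\<omega>. min 1 ((b * \<bar>X \<omega>\<bar>) powr \<alpha>) \<partial>M)
    \<le> log_moment_const \<alpha> * (b powr \<alpha> * (1 + max 0 (ln (1 / b))))"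
proof (cases "b \<le> 1")
  case False
  have "(\<integral>\<omega>. min 1 ((b * \<bar>X \<omega>\<bar>) powr \<alpha>) \<partial>M) \<le> (\<integral>\<omega>. 1 \<partial>M)"
    by (intro integral_mono) (auto intro!: integrable_const_bound[where B=1])
  also have "\<dots> = 1 * (1 * 1)" by (simp add: prob_space)
  also have "\<dots> \<le> log_moment_const \<alpha> * (b powr \<alpha> * (1 + max 0 (ln (1 / b))))"
    using False log_moment_const_ge_1[OF \<open>0 < \<alpha>\<close>] assms
    by (intro mult_mono) (auto intro!: ge_one_powr_ge_zero)
  finally show ?thesis .
next
  case True
  let ?C = "moment_const \<alpha>"
  define J where "J = nat \<lfloor>log 2 (1 / b)\<rfloor>"
  have l0: "0 \<le> log 2 (1 / b)" using True assms by simp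
  have "log 2 (1 / b) < real (Suc J)" using l0 unfolding J_def by linarith
  then have "1 / b < 2 powr real (Suc J)" using assms by (subst (asm) log_less_iff) auto
  then have "1 / b < 2 ^ Suc J" by (subst (asm) powr_realpow) auto
  note dy = min_one_powr_le_dyadic_sum[OF \<open>0 < \<alpha>\<close> \<open>0 < b\<close> this]
  have int[intro, simp]: "integrable M (\<lambda>\<omega>. min 1 (((1 / 2 ^ j) * X \<omega>)\<^sup>2))" for j :: nat
    by (rule integrable_const_bound[where B=1]) auto
  have "(\<integral>\<omega>. min 1 ((b * \<bar>X \<omega>\<bar>) powr \<alpha>) \<partial>M)
    \<le> (\<integral>\<omega>. b powr \<alpha> + 2 powr \<alpha> * (\<Sum>j\<le>J. (b * 2 ^ j) powr \<alpha> * min 1 (((1 / 2 ^ j) * X \<omega>)\<^sup>2)) \<partial>M)"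
    using dy by (intro integral_mono)
      (auto intro!: integrable_const_bound[where B=1] Bochner_Integration.integrable_add
         integrable_mult_right Bochner_Integration.integrable_sum int simp del: mult_cancel_left)
  also have "\<dots> = b powr \<alpha> + 2 powr \<alpha> *
      (\<Sum>j\<le>J. (b * 2 ^ j) powr \<alpha> * (\<integral>\<omega>. min 1 (((1 / 2 ^ j) * X \<omega>)\<^sup>2) \<partial>M))"
    by (subst Bochner_Integration.integral_add)
       (auto simp: prob_space Bochner_Integration.integral_sum simp del: times_divide_eq_left
         intro!: integrable_mult_right Bochner_Integration.integrable_sum int)
  also have "\<dots> \<le> b powr \<alpha> + 2 powr \<alpha> * (\<Sum>j\<le>J. ?C * b powr \<alpha>)"
  proof (intro add_left_mono mult_left_mono sum_mono)
    fix j
    have "(b * 2 ^ j) powr \<alpha> * (\<integral>\<omega>. min 1 (((1 / 2 ^ j) * X \<omega>)\<^sup>2) \<partial>M)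
      \<le> (b * 2 ^ j) powr \<alpha> * (?C * (1 * \<bar>1 / 2 ^ j\<bar> powr \<alpha>))"
      by (intro mult_left_mono expectation_min_one_square_scaled_le) (use assms in auto)
    also have "\<dots> = ?C * b powr \<alpha>"
      using assms by (simp add: powr_mult powr_divide)
    finally show "(b * 2 ^ j) powr \<alpha> * (\<integral>\<omega>. min 1 (((1 / 2 ^ j) * X \<omega>)\<^sup>2) \<partial>M) \<le> ?C * b powr \<alpha>" .
  qed auto
  also have "\<dots> = b powr \<alpha> * (1 + 2 powr \<alpha> * ?C * real (Suc J))" by (simp add: algebra_simps)
  also have "\<dots> \<le> b powr \<alpha> * (log_moment_const \<alpha> * (1 + max 0 (ln (1 / b))))"
  proof (intro mult_left_mono)
    have "real J \<le> log 2 (1 / b)" using l0 unfolding J_def by linarith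
    also have "\<dots> = ln (1 / b) / ln 2" by (simp add: log_def)
    \<comment> \<open>Since ln 2 \<ge> 1/2, the binary logarithm is at most twice the natural
      one.\<close>
    also have "\<dots> \<le> ln (1 / b) / (1 / 2)"
      using True assms ln2_ge_two_thirds by (intro divide_left_mono) auto
    finally have J: "real (Suc J) \<le> 2 * (1 + max 0 (ln (1 / b)))" by (auto simp: max_def)
    have "1 + 2 powr \<alpha> * ?C * real (Suc J) \<le> 1 + 2 powr \<alpha> * ?C * (2 * (1 + max 0 (ln (1 / b))))"
      using J moment_const_nonneg[OF \<open>0 < \<alpha>\<close>] by (intro add_left_mono mult_left_mono) auto
    also have "\<dots> \<le> log_moment_const \<alpha> * (1 + max 0 (ln (1 / b)))"
      by (simp add: log_moment_const_def algebra_simps)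
    finally show "1 + 2 powr \<alpha> * ?C * real (Suc J) \<le> log_moment_const \<alpha> * (1 + max 0 (ln (1 / b)))" .
  qed simp
  finally show ?thesis by (simp add: mult_ac)
qed

text \<open>By Fubini, X is frozen at x; then b x Y is a scaled stable variable and its truncated
  second moment is at most min 1 (C |b x|^\<alpha>), hence at most (1 + C) min 1 (|b x|^\<alpha>).
  Integrating over x leaves the truncated \<alpha>-th moment with its logarithm.\<close>

lemma (in prob_space) expectation_min_one_square_product_le:
  assumes indep: "indep_var borel X borel Y" and "0 < \<alpha>"
    and char_X: "\<And>t. char (distr M borel X) t = exp (- complex_of_real (\<bar>t\<bar> powr \<alpha>))"
    and char_Y: "\<And>t. char (distr M borel Y) t = exp (- complex_of_real (\<bar>t\<bar> powr \<alpha>))"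
  shows "(\<integral>\<omega>. min 1 ((b * (X \<omega> * Y \<omega>))\<^sup>2) \<partial>M)
    \<le> (1 + moment_const \<alpha>) * log_moment_const \<alpha> * (\<bar>b\<bar> powr \<alpha> * (1 + max 0 (ln (1 / \<bar>b\<bar>))))"
proof (cases "b = 0")
  case True then show ?thesis by simp
next
  case False
  have [measurable]: "X \<in> borel_measurable M" "Y \<in> borel_measurable M"
    using indep indep_var_rv1 indep_var_rv2 by auto
  interpret PX: prob_space "distr M borel X" by (rule prob_space_distr) simp
  interpret PY: prob_space "distr M borel Y" by (rule prob_space_distr) simp
  interpret PXY: pair_prob_space "distr M borel X" "distr M borel Y" ..
  have int: "integrable (distr M borel X \<Otimes>\<^sub>M distr M borel Y) (\<lambda>z. min 1 ((b * (fst z * snd z))\<^sup>2))"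
    by (rule PXY.integrable_const_bound[where B=1]) auto
  have "(\<integral>\<omega>. min 1 ((b * (X \<omega> * Y \<omega>))\<^sup>2) \<partial>M)
    = (\<integral>z. min 1 ((b * (fst z * snd z))\<^sup>2) \<partial>distr M (borel \<Otimes>\<^sub>M borel) (\<lambda>\<omega>. (X \<omega>, Y \<omega>)))"
    by (subst integral_distr) auto
  also have "\<dots> = (\<integral>z. min 1 ((b * (fst z * snd z))\<^sup>2) \<partial>(distr M borel X \<Otimes>\<^sub>M distr M borel Y))"
    using indep by (subst (asm) indep_var_distribution_eq) simp
  also have "\<dots> = (\<integral>x. (\<integral>y. min 1 ((b * (fst (x, y) * snd (x, y)))\<^sup>2) \<partial>distr M borel Y) \<partial>distr M borel X)"
    by (rule PXY.integral_fst'[symmetric, OF int])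
  also have "\<dots> = (\<integral>x. (\<integral>\<omega>. min 1 ((b * x * Y \<omega>)\<^sup>2) \<partial>M) \<partial>distr M borel X)"
    by (simp add: integral_distr mult_ac)
  also have "\<dots> \<le> (\<integral>x. (1 + moment_const \<alpha>) * min 1 ((\<bar>b\<bar> * \<bar>x\<bar>) powr \<alpha>) \<partial>distr M borel X)"
  proof (rule integral_mono)
    show "integrable (distr M borel X) (\<lambda>x. \<integral>\<omega>. min 1 ((b * x * Y \<omega>)\<^sup>2) \<partial>M)"
      using PXY.integrable_fst'[OF int] by (simp add: integral_distr mult_ac)
    show "integrable (distr M borel X) (\<lambda>x. (1 + moment_const \<alpha>) * min 1 ((\<bar>b\<bar> * \<bar>x\<bar>) powr \<alpha>))"
      by (intro integrable_mult_right PX.integrable_const_bound[where B=1]) auto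
    fix x
    have "(\<integral>\<omega>. min 1 ((b * x * Y \<omega>)\<^sup>2) \<partial>M) \<le> moment_const \<alpha> * (1 * \<bar>b * x\<bar> powr \<alpha>)"
      by (rule expectation_min_one_square_scaled_le) (use assms in auto)
    moreover have "(\<integral>\<omega>. min 1 ((b * x * Y \<omega>)\<^sup>2) \<partial>M) \<le> (\<integral>\<omega>. 1 \<partial>M)"
      by (intro integral_mono) (auto intro!: integrable_const_bound[where B=1])
    moreover have "moment_const \<alpha> * z \<le> (1 + moment_const \<alpha>) * z" if "0 \<le> z" for z
      using that by (simp add: algebra_simps)
    moreover have "1 \<le> (1 + moment_const \<alpha>) * 1" using moment_const_nonneg[OF \<open>0 < \<alpha>\<close>] by simp
    ultimately show "(\<integral>\<omega>. min 1 ((b * x * Y \<omega>)\<^sup>2) \<partial>M) \<le> (1 + moment_const \<alpha>) * min 1 ((\<bar>b\<bar> * \<bar>x\<bar>) powr \<alpha>)"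
      by (auto simp: min_def abs_mult prob_space intro: order_trans)
  qed
  also have "\<dots> = (1 + moment_const \<alpha>) * (\<integral>\<omega>. min 1 ((\<bar>b\<bar> * \<bar>X \<omega>\<bar>) powr \<alpha>) \<partial>M)"
    by (subst integral_mult_right_zero) (simp add: integral_distr)
  also have "\<dots> \<le> (1 + moment_const \<alpha>) * (log_moment_const \<alpha> * (\<bar>b\<bar> powr \<alpha> * (1 + max 0 (ln (1 / \<bar>b\<bar>)))))"
    using False assms moment_const_nonneg[OF \<open>0 < \<alpha>\<close>]
    by (intro mult_left_mono expectation_min_one_powr_le) auto
  finally show ?thesis by (simp add: mult.assoc)
qed

subsection \<open>Off-diagonal quadratic forms\<close>

text \<open>An even characteristic function means that X_i and -X_i have the same law. By
  independence the joint law is the product of the marginals, so it does not change when X_i alone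
  is replaced by -X_i.\<close>

lemma (in prob_space) expectation_sign_flip:
  fixes X :: "'i \<Rightarrow> 'a \<Rightarrow> real" and F :: "('i \<Rightarrow> real) \<Rightarrow> real"
  assumes indep: "indep_vars (\<lambda>_. borel) X I" and "i \<in> I"
    and sym: "\<And>t. char (distr M borel (X i)) (- t) = char (distr M borel (X i)) t"
    and F: "F \<in> borel_measurable (PiM I (\<lambda>_. borel))"
  shows "(\<integral>\<omega>. F (\<lambda>j\<in>I. X j \<omega>) \<partial>M) = (\<integral>\<omega>. F (\<lambda>j\<in>I. if j = i then - X j \<omega> else X j \<omega>) \<partial>M)"
proof -
  define X' where "X' j \<omega> = (if j = i then - X j \<omega> else X j \<omega>)" for j \<omega>
  have rv[measurable]: "X j \<in> borel_measurable M" if "j \<in> I" for j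
    using indep that by (auto simp: indep_vars_def)
  have "indep_vars (\<lambda>_. borel) (\<lambda>j \<omega>. (if j = i then uminus else id) (X j \<omega>)) I"
    by (rule indep_vars_compose2[OF indep]) auto
  then have indep': "indep_vars (\<lambda>_. borel) X' I"
    by (rule back_subst[of "\<lambda>Z. indep_vars (\<lambda>_. borel) Z I"]) (auto simp: X'_def fun_eq_iff)
  have rv': "X' j \<in> borel_measurable M" if "j \<in> I" for j
    using indep' that by (auto simp: indep_vars_def)
  have "distr M borel (\<lambda>\<omega>. - X i \<omega>) = distr M borel (X i)"
  proof (rule Levy_uniqueness)
    show "char (distr M borel (\<lambda>\<omega>. - X i \<omega>)) = char (distr M borel (X i))"
    proof
      fix t
      have "char (distr M borel (\<lambda>\<omega>. - X i \<omega>)) t = char (distr M borel (X i)) (- t)"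
        using \<open>i \<in> I\<close> by (simp add: char_def integral_distr)
      then show "char (distr M borel (\<lambda>\<omega>. - X i \<omega>)) t = char (distr M borel (X i)) t" by (simp add: sym)
    qed
  qed (use \<open>i \<in> I\<close> in \<open>auto intro!: real_distribution_distr\<close>)
  moreover have "X' j = (if j = i then \<lambda>\<omega>. - X i \<omega> else X j)" for j
    by (auto simp: X'_def fun_eq_iff)
  ultimately have "distr M borel (X' j) = distr M borel (X j)" for j by simp
  moreover have "distr M (PiM I (\<lambda>_. borel)) (\<lambda>\<omega>. \<lambda>j\<in>I. X j \<omega>) = PiM I (\<lambda>j. distr M borel (X j))"
    using indep \<open>i \<in> I\<close> by (subst (asm) indep_vars_iff_distr_eq_PiM') auto
  moreover have "distr M (PiM I (\<lambda>_. borel)) (\<lambda>\<omega>. \<lambda>j\<in>I. X' j \<omega>) = PiM I (\<lambda>j. distr M borel (X' j))"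
    using indep' \<open>i \<in> I\<close> rv' by (subst (asm) indep_vars_iff_distr_eq_PiM') auto
  ultimately have "(\<integral>f. F f \<partial>distr M (PiM I (\<lambda>_. borel)) (\<lambda>\<omega>. \<lambda>j\<in>I. X j \<omega>))
     = (\<integral>f. F f \<partial>distr M (PiM I (\<lambda>_. borel)) (\<lambda>\<omega>. \<lambda>j\<in>I. X' j \<omega>))"
    by simp
  moreover have "(\<lambda>\<omega>. \<lambda>j\<in>I. X j \<omega>) \<in> measurable M (PiM I (\<lambda>_. borel))"
    by (rule measurable_restrict) (rule rv)
  moreover have "(\<lambda>\<omega>. \<lambda>j\<in>I. X' j \<omega>) \<in> measurable M (PiM I (\<lambda>_. borel))"
    by (rule measurable_restrict) (rule rv')
  ultimately show ?thesis
    using F by (simp add: integral_distr X'_def)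
qed

text \<open>The truncation is clipping, because it is odd, so sign flips pass through it, and its
  square is exactly \<open>min 1 (y\<^sup>2)\<close>, the quantity already estimated.\<close>

definition cut :: "real \<Rightarrow> real" where
  "cut y = max (- 1) (min 1 y)"

lemma cut_minus [simp]: "cut (- y) = - cut y"
  by (auto simp: cut_def max_def min_def)

lemma abs_cut_le_1: "\<bar>cut y\<bar> \<le> 1"
  by (auto simp: cut_def)

lemma cut_eq: "\<bar>y\<bar> \<le> 1 \<Longrightarrow> cut y = y"
  by (auto simp: cut_def)

lemma cut_square: "(cut y)\<^sup>2 = min 1 (y\<^sup>2)"
proof (cases "\<bar>y\<bar> \<le> 1")
  case True
  then have "y\<^sup>2 \<le> 1" by (simp add: abs_square_le_1)
  then show ?thesis using True by (simp add: cut_eq)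
next
  case False
  then have "cut y = 1 \<or> cut y = -1" by (auto simp: cut_def)
  moreover have "\<not> y\<^sup>2 \<le> 1" using False by (simp add: abs_square_le_1)
  ultimately show ?thesis by (auto simp: min_def)
qed

lemma cut_measurable [measurable]: "cut \<in> borel_measurable borel"
  unfolding cut_def by measurable

text \<open>The variable X_i enters the first factor once and the second not at all, so flipping its
  sign negates the integrand and the expectation equals its own negative. The indices
  \<open>j\<close>, \<open>k\<close>, \<open>l\<close> may coincide.\<close>

lemma (in prob_space) expectation_cut_products_eq_0:
  fixes X :: "'i \<Rightarrow> 'a \<Rightarrow> real"
  assumes indep: "indep_vars (\<lambda>_. borel) X UNIV"
    and sym: "\<And>t. char (distr M borel (X i)) (- t) = char (distr M borel (X i)) t"
    and "i \<notin> {j, k, l}"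
  shows "(\<integral>\<omega>. cut (b * (X i \<omega> * X j \<omega>)) * cut (c * (X k \<omega> * X l \<omega>)) \<partial>M) = 0"
proof -
  let ?I = "{i, j, k, l}"
  define F where "F = (\<lambda>f :: 'i \<Rightarrow> real. cut (b * (f i * f j)) * cut (c * (f k * f l)))"
  have "F \<in> borel_measurable (PiM ?I (\<lambda>_. borel))"
    unfolding F_def by measurable
  then have "(\<integral>\<omega>. F (\<lambda>j\<in>?I. X j \<omega>) \<partial>M) = (\<integral>\<omega>. F (\<lambda>j\<in>?I. if j = i then - X j \<omega> else X j \<omega>) \<partial>M)"
    by (intro expectation_sign_flip indep_vars_subset[OF indep] sym) auto
  also have "\<dots> = (\<integral>\<omega>. - F (\<lambda>j\<in>?I. X j \<omega>) \<partial>M)"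
    using \<open>i \<notin> {j, k, l}\<close> by (intro Bochner_Integration.integral_cong) (auto simp: F_def)
  finally show ?thesis by (simp add: F_def)
qed

lemma (in prob_space) expectation_abs_le_sqrt:
  fixes Z :: "'a \<Rightarrow> real"
  assumes [measurable]: "Z \<in> borel_measurable M" and bound: "\<And>\<omega>. \<bar>Z \<omega>\<bar> \<le> B"
  shows "(\<integral>\<omega>. \<bar>Z \<omega>\<bar> \<partial>M) \<le> sqrt (\<integral>\<omega>. (Z \<omega>)\<^sup>2 \<partial>M)"
proof -
  have B: "0 \<le> B" using bound[of undefined] by linarith
  have 1: "integrable M (\<lambda>\<omega>. \<bar>Z \<omega>\<bar>)"
    by (rule integrable_const_bound[where B=B]) (use bound in auto)
  have "(Z \<omega>)\<^sup>2 \<le> B\<^sup>2" for \<omega> using bound[of \<omega>] B by (simp flip: abs_le_square_iff)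
  then have 2: "integrable M (\<lambda>\<omega>. \<bar>Z \<omega>\<bar>\<^sup>2)"
    by (intro integrable_const_bound[where B="B\<^sup>2"]) auto
  have "0 \<le> variance (\<lambda>\<omega>. \<bar>Z \<omega>\<bar>)" by (rule variance_positive)
  then have "(\<integral>\<omega>. \<bar>Z \<omega>\<bar> \<partial>M)\<^sup>2 \<le> (\<integral>\<omega>. (Z \<omega>)\<^sup>2 \<partial>M)"
    using variance_eq[OF 1 2] by simp
  then show ?thesis by (rule real_le_rsqrt)
qed

text \<open>Once the summands are truncated by an odd function, distinct ones are uncorrelated, because
  some variable occurs in only one of the two: flipping its sign flips the sign of their product.\<close>

lemma (in prob_space) expectation_min_one_quadratic_form_le:
  fixes X :: "'i::linorder \<Rightarrow> 'a \<Rightarrow> real" and u v :: "'p \<Rightarrow> 'i" and b :: "'p \<Rightarrow> real"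
  assumes indep: "indep_vars (\<lambda>_. borel) X UNIV"
    and sym: "\<And>i t. char (distr M borel (X i)) (- t) = char (distr M borel (X i)) t"
    and "finite P" and less: "\<And>p. p \<in> P \<Longrightarrow> u p < v p"
    and inj: "inj_on (\<lambda>p. (u p, v p)) P"
  defines "S \<equiv> (\<Sum>p\<in>P. \<integral>\<omega>. min 1 ((b p * (X (u p) \<omega> * X (v p) \<omega>))\<^sup>2) \<partial>M)"
  shows "(\<integral>\<omega>. min 1 \<bar>\<Sum>p\<in>P. b p * (X (u p) \<omega> * X (v p) \<omega>)\<bar> \<partial>M) \<le> S + sqrt S"
proof -
  have [measurable]: "X i \<in> borel_measurable M" for i
    using indep by (auto simp: indep_vars_def)
  define y where "y p \<omega> = b p * (X (u p) \<omega> * X (v p) \<omega>)" for p \<omega>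
  define Z where "Z \<omega> = (\<Sum>p\<in>P. cut (y p \<omega>))" for \<omega>
  have [measurable]: "y p \<in> borel_measurable M" for p unfolding y_def by measurable
  have [measurable]: "Z \<in> borel_measurable M" unfolding Z_def by measurable
  have cut_le: "\<bar>cut (y p \<omega>) * cut (y q \<omega>)\<bar> \<le> 1" for p q \<omega>
    using mult_mono[OF abs_cut_le_1[of "y p \<omega>"] abs_cut_le_1[of "y q \<omega>"]] by (simp add: abs_mult)
  have int2[simp]: "integrable M (\<lambda>\<omega>. cut (y p \<omega>) * cut (y q \<omega>))" for p q
    by (rule integrable_const_bound[where B=1]) (use cut_le in auto)
  have int1[simp]: "integrable M (\<lambda>\<omega>. min 1 ((y p \<omega>)\<^sup>2))" for p
    by (rule integrable_const_bound[where B=1]) auto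
  have Z_le: "\<bar>Z \<omega>\<bar> \<le> real (card P)" for \<omega>
    using sum_norm_bound[of P "\<lambda>p. cut (y p \<omega>)" 1] abs_cut_le_1 by (simp add: Z_def)
  have intZ: "integrable M (\<lambda>\<omega>. \<bar>Z \<omega>\<bar>)"
    by (rule integrable_const_bound[where B="real (card P)"]) (use Z_le in auto)
  have cross: "(\<integral>\<omega>. cut (y p \<omega>) * cut (y q \<omega>) \<partial>M) = 0" if "p \<in> P" "q \<in> P" "p \<noteq> q" for p q
  proof -
    have ne: "(u p, v p) \<noteq> (u q, v q)" using inj_onD[OF inj _ that(1,2)] that(3) by blast
    \<comment> \<open>If both x and y belonged to {z, w}, the orderings x < y and z < w would force
      the two pairs to be equal. This is why the form is indexed by increasing pairs.\<close>
    have "x \<notin> {y, z, w} \<or> y \<notin> {x, z, w}" if "x < y" "z < w" "(x, y) \<noteq> (z, w)" for x y z w :: 'i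
      using that by (metis empty_iff insert_iff order.asym order.irrefl)
    from this[OF less[OF that(1)] less[OF that(2)] ne]
    have "u p \<notin> {v p, u q, v q} \<or> v p \<notin> {u p, u q, v q}" .
    then show ?thesis
    proof
      assume "u p \<notin> {v p, u q, v q}"
      then show ?thesis unfolding y_def by (rule expectation_cut_products_eq_0[OF indep sym])
    next
      assume "v p \<notin> {u p, u q, v q}"
      then show ?thesis
        using expectation_cut_products_eq_0[OF indep sym, of "v p" "u p" "u q" "v q" "b p" "b q"]
        by (simp add: y_def mult.commute)
    qed
  qed
  have "(\<integral>\<omega>. (Z \<omega>)\<^sup>2 \<partial>M) = (\<integral>\<omega>. (\<Sum>p\<in>P. \<Sum>q\<in>P. cut (y p \<omega>) * cut (y q \<omega>)) \<partial>M)"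
    by (simp add: Z_def power2_eq_square sum_product)
  also have "\<dots> = (\<Sum>p\<in>P. \<Sum>q\<in>P. \<integral>\<omega>. cut (y p \<omega>) * cut (y q \<omega>) \<partial>M)"
    by (simp add: Bochner_Integration.integral_sum)
  also have "\<dots> = (\<Sum>p\<in>P. \<Sum>q\<in>P. if q = p then \<integral>\<omega>. (cut (y p \<omega>))\<^sup>2 \<partial>M else 0)"
    by (intro sum.cong refl) (auto simp: cross power2_eq_square)
  also have "\<dots> = S"
    using \<open>finite P\<close> by (simp add: S_def cut_square y_def)
  finally have Z2: "(\<integral>\<omega>. (Z \<omega>)\<^sup>2 \<partial>M) = S" .
  \<comment> \<open>Either some summand exceeds 1 in modulus, and its truncated square alone is 1,
    or no summand was clipped and the form coincides with \<open>Z\<close>.\<close>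
  have "min 1 \<bar>\<Sum>p\<in>P. y p \<omega>\<bar> \<le> (\<Sum>p\<in>P. min 1 ((y p \<omega>)\<^sup>2)) + \<bar>Z \<omega>\<bar>" for \<omega>
  proof (cases "\<exists>p\<in>P. \<not> \<bar>y p \<omega>\<bar> \<le> 1")
    case True
    then obtain p where p: "p \<in> P" "\<not> \<bar>y p \<omega>\<bar> \<le> 1" by blast
    then have "\<not> (y p \<omega>)\<^sup>2 \<le> 1" by (simp add: abs_square_le_1)
    then have "1 = (\<Sum>p\<in>{p}. min 1 ((y p \<omega>)\<^sup>2))" by simp
    also have "\<dots> \<le> (\<Sum>p\<in>P. min 1 ((y p \<omega>)\<^sup>2))"
      using p \<open>finite P\<close> by (intro sum_mono2) auto
    finally show ?thesis by linarith
  next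
    case False
    then have "Z \<omega> = (\<Sum>p\<in>P. y p \<omega>)" unfolding Z_def by (intro sum.cong) (auto simp: cut_eq)
    moreover have "0 \<le> (\<Sum>p\<in>P. min 1 ((y p \<omega>)\<^sup>2))" by (intro sum_nonneg) auto
    ultimately show ?thesis by linarith
  qed
  then have "(\<integral>\<omega>. min 1 \<bar>\<Sum>p\<in>P. y p \<omega>\<bar> \<partial>M) \<le> (\<integral>\<omega>. (\<Sum>p\<in>P. min 1 ((y p \<omega>)\<^sup>2)) + \<bar>Z \<omega>\<bar> \<partial>M)"
    by (intro integral_mono integrable_const_bound[where B=1] Bochner_Integration.integrable_add
        Bochner_Integration.integrable_sum int1 intZ) auto
  also have "\<dots> = S + (\<integral>\<omega>. \<bar>Z \<omega>\<bar> \<partial>M)"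
    using intZ by (simp add: Bochner_Integration.integral_sum S_def y_def[symmetric])
  also have "\<dots> \<le> S + sqrt S"
    using expectation_abs_le_sqrt[of Z "real (card P)"] Z_le Z2 by simp
  finally show ?thesis by (simp add: y_def)
qed

section \<open>The normalised contribution of the large lags\<close>

text \<open>The cost of a whole lag with coefficient a, in a form independent of n. The term
  2/\<alpha> is what the logarithm of the normaliser leaves behind; the other terms are those of the
  two series defining the sequence space.\<close>

definition log_weight :: "real \<Rightarrow> real \<Rightarrow> real" where
  "log_weight \<alpha> a = (1 + 2 / \<alpha>) * \<bar>a\<bar> powr \<alpha>
     + (if a = 0 then 0 else \<bar>a\<bar> powr \<alpha> * max 0 (ln (1 / \<bar>a\<bar>)))"

lemma log_weight_nonneg: "0 < \<alpha> \<Longrightarrow> 0 \<le> log_weight \<alpha> a"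
  by (auto simp: log_weight_def intro!: add_nonneg_nonneg mult_nonneg_nonneg)

lemma summable_log_weight: "a \<in> ell_alpha_log \<alpha> \<Longrightarrow> summable (\<lambda>k. log_weight \<alpha> (a (Suc k)))"
  unfolding log_weight_def ell_alpha_log_def by (auto intro!: summable_add summable_mult)

lemma ln_ge_1: "3 \<le> n \<Longrightarrow> 1 \<le> ln (real n)"
  using e_less_272 by (subst ln_ge_iff) auto

text \<open>The factor n cancels the n in |b|^\<alpha> = |a|^\<alpha> / (n ln n), and the remaining
  1 / ln n absorbs the summand (1/\<alpha>) ln (n ln n) of ln (1/|b|). From n = 3 on ln n is at
  least 1, so the other terms only shrink.\<close>

lemma normalized_log_moment_le:
  fixes a :: real
  assumes "0 < \<alpha>" "3 \<le> n"
  defines "b \<equiv> (real n * ln (real n)) powr (- 1 / \<alpha>) * a"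
  shows "real n * (\<bar>b\<bar> powr \<alpha> * (1 + max 0 (ln (1 / \<bar>b\<bar>)))) \<le> log_weight \<alpha> a"
proof (cases "a = 0")
  case True
  then show ?thesis using assms by (simp add: log_weight_def)
next
  case False
  let ?l = "ln (real n)" and ?q = "real n * ln (real n)" and ?L = "max 0 (ln (1 / \<bar>a\<bar>))"
  have l: "1 \<le> ?l" by (rule ln_ge_1) fact
  have q: "0 < ?q" using l assms by (intro mult_pos_pos) auto
  have b: "\<bar>b\<bar> powr \<alpha> = \<bar>a\<bar> powr \<alpha> / ?q"
  proof -
    have "(?q powr (- 1 / \<alpha>)) powr \<alpha> = inverse ?q"
      using \<open>0 < \<alpha>\<close> q unfolding powr_powr by (simp add: powr_minus)
    then show ?thesis by (simp add: b_def abs_mult powr_mult divide_inverse mult.commute)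
  qed
  have "ln (1 / \<bar>b\<bar>) = ln (1 / \<bar>a\<bar>) + (1 / \<alpha>) * ln ?q"
    using False q l assms by (simp add: b_def abs_mult ln_mult ln_div ln_powr)
  \<comment> \<open>From ln n \<le> n one gets ln (n ln n) = ln n + ln (ln n) \<le> 2 ln n, the
    source of the 2 in \<open>log_weight\<close>.\<close>
  moreover have "ln ?q \<le> 2 * ?l"
  proof -
    have "?l \<le> real n" using assms ln_le_minus_one[of "real n"] by simp
    then have "ln ?l \<le> ?l" using l assms by (subst ln_le_cancel_iff) auto
    then show ?thesis using l assms by (simp add: ln_mult)
  qed
  ultimately have "ln (1 / \<bar>b\<bar>) \<le> ?L + (1 / \<alpha>) * (2 * ?l)"
    using assms by (simp only:) (intro add_mono mult_left_mono, auto)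
  moreover have "0 \<le> (1 / \<alpha>) * (2 * ?l)" using l assms by simp
  ultimately have "1 + max 0 (ln (1 / \<bar>b\<bar>)) \<le> 1 + (?L + (2 / \<alpha>) * ?l)" by auto
  also have "\<dots> \<le> ?l * (1 + ?L + 2 / \<alpha>)"
    using mult_right_mono[of 1 ?l "1 + ?L"] l by (simp add: algebra_simps)
  finally have "real n * (\<bar>b\<bar> powr \<alpha> * (1 + max 0 (ln (1 / \<bar>b\<bar>))))
      \<le> real n * (\<bar>b\<bar> powr \<alpha> * (?l * (1 + ?L + 2 / \<alpha>)))"
    by (intro mult_left_mono) auto
  also have "\<dots> = \<bar>a\<bar> powr \<alpha> * (1 + ?L + 2 / \<alpha>)"
    unfolding b using l \<open>3 \<le> n\<close> by simp
  also have "\<dots> = log_weight \<alpha> a" using False by (simp add: log_weight_def algebra_simps)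
  finally show ?thesis .
qed

definition tail_const :: "real \<Rightarrow> real" where
  "tail_const \<alpha> = (1 + moment_const \<alpha>) * log_moment_const \<alpha>"

lemma tail_const_nonneg: "0 < \<alpha> \<Longrightarrow> 0 \<le> tail_const \<alpha>"
  using moment_const_nonneg[of \<alpha>] log_moment_const_ge_1[of \<alpha>] by (simp add: tail_const_def)

text \<open>A set of positive lags gives an off-diagonal form whose coefficient depends on the lag
  alone. Each lag has at most n pairs, which is exactly what the normalisation compensates, so the
  bound \<open>W\<close> is free of n.\<close>

lemma (in prob_space) expectation_tail_le:
  fixes eps :: "int \<Rightarrow> 'a \<Rightarrow> real" and a :: "nat \<Rightarrow> real"
  assumes "0 < \<alpha>" and indep: "indep_vars (\<lambda>_. borel) eps UNIV"
    and char: "\<And>t u. char (distr M borel (eps t)) u = exp (- complex_of_real (\<bar>u\<bar> powr \<alpha>))"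
    and "3 \<le> n" "finite K" "K \<subseteq> {1..}"
  defines "W \<equiv> tail_const \<alpha> * (\<Sum>k\<in>K. log_weight \<alpha> (a k))"
  shows "(\<integral>\<omega>. min 1 \<bar>(real n * ln (real n)) powr (- 1 / \<alpha>) *
      (\<Sum>k\<in>K. a k * (real n * gamma_n eps n k \<omega>))\<bar> \<partial>M) \<le> W + sqrt W"
proof -
  define c where "c = (real n * ln (real n)) powr (- 1 / \<alpha>)"
  \<comment> \<open>A point (k, t) stands for the pair of times t < t + k. The correspondence is
    injective because the lag is recovered as the difference.\<close>
  define P where "P = (SIGMA k:K. {1..int n - int k})"
  have fin: "finite P" using assms by (auto simp: P_def)
  let ?b = "\<lambda>p. c * a (fst p)" and ?u = "snd" and ?v = "\<lambda>p. snd p + int (fst p)"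
  define S where "S = (\<Sum>p\<in>P. \<integral>\<omega>. min 1 ((?b p * (eps (?u p) \<omega> * eps (?v p) \<omega>))\<^sup>2) \<partial>M)"
  have Q: "c * (\<Sum>k\<in>K. a k * (real n * gamma_n eps n k \<omega>))
      = (\<Sum>p\<in>P. ?b p * (eps (?u p) \<omega> * eps (?v p) \<omega>))" for \<omega>
  proof -
    have "(\<Sum>p\<in>P. ?b p * (eps (?u p) \<omega> * eps (?v p) \<omega>))
      = (\<Sum>(k, t)\<in>P. c * a k * (eps t \<omega> * eps (t + int k) \<omega>))"
      by (intro sum.cong) auto
    also have "\<dots> = (\<Sum>k\<in>K. \<Sum>t\<in>{1..int n - int k}. c * a k * (eps t \<omega> * eps (t + int k) \<omega>))"
      unfolding P_def by (rule sum.Sigma[symmetric]) (use assms in auto)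
    also have "\<dots> = c * (\<Sum>k\<in>K. a k * (real n * gamma_n eps n k \<omega>))"
      using assms by (simp add: gamma_n_def sum_distrib_left mult_ac)
    finally show ?thesis by simp
  qed
  have "(\<integral>\<omega>. min 1 \<bar>\<Sum>p\<in>P. ?b p * (eps (?u p) \<omega> * eps (?v p) \<omega>)\<bar> \<partial>M) \<le> S + sqrt S"
    unfolding S_def
  proof (rule expectation_min_one_quadratic_form_le[OF indep _ fin])
    show "inj_on (\<lambda>p. (snd p, snd p + int (fst p))) P" by (auto intro!: inj_onI simp: prod_eq_iff)
    show "snd p < snd p + int (fst p)" if "p \<in> P" for p
      using that assms by (auto simp: P_def)
  qed (simp add: char)
  also have "S + sqrt S \<le> W + sqrt W"
  proof -
    have ind: "indep_var borel (eps i) borel (eps j)" if "i \<noteq> j" for i j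
    proof -
      have "indep_var (PiM {i} (\<lambda>_. borel)) (\<lambda>\<omega>. restrict (\<lambda>i. eps i \<omega>) {i}) (PiM {j} (\<lambda>_. borel)) (\<lambda>\<omega>. restrict (\<lambda>i. eps i \<omega>) {j})"
        by (rule indep_var_restrict[OF indep]) (use that in auto)
      then have "indep_var borel ((\<lambda>f. f i) \<circ> (\<lambda>\<omega>. restrict (\<lambda>i. eps i \<omega>) {i})) borel ((\<lambda>f. f j) \<circ> (\<lambda>\<omega>. restrict (\<lambda>i. eps i \<omega>) {j}))"
        by (rule indep_var_compose) auto
      then show ?thesis by (simp add: comp_def)
    qed
    have "S \<le> (\<Sum>p\<in>P. tail_const \<alpha> * (\<bar>?b p\<bar> powr \<alpha> * (1 + max 0 (ln (1 / \<bar>?b p\<bar>)))))"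
      unfolding S_def tail_const_def
    proof (rule sum_mono)
      fix p assume "p \<in> P"
      then have "?u p \<noteq> ?v p" using assms by (auto simp: P_def)
      then show "(\<integral>\<omega>. min 1 ((?b p * (eps (?u p) \<omega> * eps (?v p) \<omega>))\<^sup>2) \<partial>M)
        \<le> (1 + moment_const \<alpha>) * log_moment_const \<alpha> * (\<bar>?b p\<bar> powr \<alpha> * (1 + max 0 (ln (1 / \<bar>?b p\<bar>))))"
        by (intro expectation_min_one_square_product_le ind char assms)
    qed
    also have "\<dots> = (\<Sum>(k, t)\<in>P. tail_const \<alpha> * (\<bar>c * a k\<bar> powr \<alpha> * (1 + max 0 (ln (1 / \<bar>c * a k\<bar>)))))"
      by (intro sum.cong) auto
    also have "\<dots> = (\<Sum>k\<in>K. \<Sum>t\<in>{1..int n - int k}. tail_const \<alpha> * (\<bar>c * a k\<bar> powr \<alpha> * (1 + max 0 (ln (1 / \<bar>c * a k\<bar>)))))"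
      unfolding P_def by (rule sum.Sigma[symmetric]) (use assms in auto)
    also have "\<dots> \<le> (\<Sum>k\<in>K. tail_const \<alpha> * log_weight \<alpha> (a k))"
    proof (rule sum_mono)
      fix k assume "k \<in> K"
      let ?z = "\<bar>c * a k\<bar> powr \<alpha> * (1 + max 0 (ln (1 / \<bar>c * a k\<bar>)))"
      have z: "0 \<le> ?z" by auto
      have "(\<Sum>t\<in>{1..int n - int k}. tail_const \<alpha> * ?z) = tail_const \<alpha> * (real (nat (int n - int k)) * ?z)"
        by simp
      also have "\<dots> \<le> tail_const \<alpha> * (real n * ?z)"
        using z tail_const_nonneg[OF \<open>0 < \<alpha>\<close>] by (intro mult_left_mono mult_right_mono) auto
      also have "\<dots> \<le> tail_const \<alpha> * log_weight \<alpha> (a k)"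
        unfolding c_def using assms
        by (intro mult_left_mono normalized_log_moment_le tail_const_nonneg) auto
      finally show "(\<Sum>t\<in>{1..int n - int k}. tail_const \<alpha> * ?z) \<le> tail_const \<alpha> * log_weight \<alpha> (a k)" .
    qed
    also have "\<dots> = W" by (simp add: W_def sum_distrib_left)
    finally show ?thesis by (intro add_mono) auto
  qed
  finally show ?thesis unfolding c_def[symmetric] Q .
qed

subsection \<open>Almost sure convergence\<close>

text \<open>Decompose by the first index j at which the partial sum exceeds 2c. That event
  \<open>A j\<close> depends on the summands before j, and \<open>B j\<close>, that the remaining
  sum is at most c, on those from j on; so they are independent, and \<open>B j\<close> has
  probability at least 1/2. On their intersection the full sum still exceeds c.\<close>

lemma (in prob_space) ottaviani_inequality:
  fixes X :: "nat \<Rightarrow> 'a \<Rightarrow> real"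
  assumes indep: "indep_vars (\<lambda>_. borel) X UNIV"
    and half: "\<And>j. m \<le> j \<Longrightarrow> j \<le> N \<Longrightarrow> prob {\<omega> \<in> space M. c < \<bar>\<Sum>k=j..<N. X k \<omega>\<bar>} \<le> 1 / 2"
  shows "prob {\<omega> \<in> space M. \<exists>j\<in>{m..N}. 2 * c < \<bar>\<Sum>k=m..<j. X k \<omega>\<bar>}
    \<le> 2 * prob {\<omega> \<in> space M. c < \<bar>\<Sum>k=m..<N. X k \<omega>\<bar>}"
proof -
  have [measurable]: "X i \<in> borel_measurable M" for i
    using indep by (auto simp: indep_vars_def)
  define A where "A j = {\<omega> \<in> space M. (\<forall>i\<in>{m..<j}. \<bar>\<Sum>k=m..<i. X k \<omega>\<bar> \<le> 2 * c) \<and> 2 * c < \<bar>\<Sum>k=m..<j. X k \<omega>\<bar>}" for j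
  define B where "B j = {\<omega> \<in> space M. \<bar>\<Sum>k=j..<N. X k \<omega>\<bar> \<le> c}" for j
  have [measurable]: "A j \<in> events" "B j \<in> events" for j
    unfolding A_def B_def by measurable
  have B_half: "1 / 2 \<le> prob (B j)" if "m \<le> j" "j \<le> N" for j
  proof -
    have "B j = space M - {\<omega> \<in> space M. c < \<bar>\<Sum>k=j..<N. X k \<omega>\<bar>}" by (auto simp: B_def)
    then show ?thesis using half[OF that] by (simp add: prob_compl)
  qed
  have AB: "prob (A j \<inter> B j) = prob (A j) * prob (B j)" if "m \<le> j" for j
  proof -
    let ?P1 = "PiM {..<j} (\<lambda>_. borel :: real measure)" and ?P2 = "PiM {j..} (\<lambda>_. borel :: real measure)"
    define A' where "A' = {f \<in> space ?P1. (\<forall>i\<in>{m..<j}. \<bar>\<Sum>k=m..<i. f k\<bar> \<le> 2 * c) \<and> 2 * c < \<bar>\<Sum>k=m..<j. f k\<bar>}"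
    define B' where "B' = {f \<in> space ?P2. \<bar>\<Sum>k=j..<N. f k\<bar> \<le> c}"
    have [measurable]: "(\<lambda>f. \<Sum>k=m..<i. f k) \<in> borel_measurable ?P1" if "i \<le> j" for i
      using that by (intro borel_measurable_sum measurable_component_singleton) auto
    have [measurable]: "(\<lambda>f. \<Sum>k=j..<N. f k) \<in> borel_measurable ?P2"
      by (intro borel_measurable_sum measurable_component_singleton) auto
    have A': "A' \<in> sets ?P1" unfolding A'_def by measurable
    have B': "B' \<in> sets ?P2" unfolding B'_def by measurable
    have ind: "indep_var ?P1 (\<lambda>\<omega>. restrict (\<lambda>i. X i \<omega>) {..<j}) ?P2 (\<lambda>\<omega>. restrict (\<lambda>i. X i \<omega>) {j..})"
      by (rule indep_var_restrict[OF indep]) auto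
    have A_eq: "(\<lambda>\<omega>. restrict (\<lambda>i. X i \<omega>) {..<j}) -` A' \<inter> space M = A j"
      by (auto simp: A_def A'_def space_PiM)
    have B_eq: "(\<lambda>\<omega>. restrict (\<lambda>i. X i \<omega>) {j..}) -` B' \<inter> space M = B j"
      by (auto simp: B_def B'_def space_PiM)
    have "(\<lambda>\<omega>. (restrict (\<lambda>i. X i \<omega>) {..<j}, restrict (\<lambda>i. X i \<omega>) {j..})) -` (A' \<times> B') \<inter> space M = A j \<inter> B j"
      using A_eq B_eq by blast
    with indep_varD[OF ind A' B'] show ?thesis unfolding A_eq B_eq by simp
  qed
  have disj: "disjoint_family_on A {m..N}"
    unfolding disjoint_family_on_def
  proof (intro ballI impI)
    fix i j assume ij: "i \<in> {m..N}" "j \<in> {m..N}" "i \<noteq> j"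
    have "A i \<inter> A j = {}" if "i < j" "m \<le> i" for i j
    proof -
      have "\<not> 2 * c < \<bar>\<Sum>k=m..<i. X k \<omega>\<bar>" if "\<omega> \<in> A j" for \<omega>
        using that \<open>i < j\<close> \<open>m \<le> i\<close> unfolding A_def by (auto simp: not_less)
      then show ?thesis by (auto simp: A_def)
    qed
    from this[of i j] this[of j i] ij show "A i \<inter> A j = {}" by (cases "i < j") auto
  qed
  have "{\<omega> \<in> space M. \<exists>j\<in>{m..N}. 2 * c < \<bar>\<Sum>k=m..<j. X k \<omega>\<bar>} = (\<Union>j\<in>{m..N}. A j)"
  proof (intro equalityI subsetI)
    fix \<omega> assume "\<omega> \<in> {\<omega> \<in> space M. \<exists>j\<in>{m..N}. 2 * c < \<bar>\<Sum>k=m..<j. X k \<omega>\<bar>}"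
    then obtain j where \<omega>: "\<omega> \<in> space M" and j: "m \<le> j" "j \<le> N" "2 * c < \<bar>\<Sum>k=m..<j. X k \<omega>\<bar>" by auto
    let ?Q = "\<lambda>j. m \<le> j \<and> 2 * c < \<bar>\<Sum>k=m..<j. X k \<omega>\<bar>"
    define l where "l = Least ?Q"
    have l: "?Q l" unfolding l_def by (rule LeastI[of ?Q j]) (use j in auto)
    have "l \<le> j" unfolding l_def by (rule Least_le) (use j in auto)
    moreover have "\<bar>\<Sum>k=m..<i. X k \<omega>\<bar> \<le> 2 * c" if "m \<le> i" "i < l" for i
      using not_less_Least[of i ?Q] that by (simp add: l_def)
    ultimately have "\<omega> \<in> A l" using l \<omega> by (auto simp: A_def)
    then show "\<omega> \<in> (\<Union>j\<in>{m..N}. A j)" using l \<open>l \<le> j\<close> j by auto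
  qed (auto simp: A_def)
  then have "prob {\<omega> \<in> space M. \<exists>j\<in>{m..N}. 2 * c < \<bar>\<Sum>k=m..<j. X k \<omega>\<bar>} = (\<Sum>j=m..N. prob (A j))"
    using disj by (simp add: finite_measure_finite_Union image_subset_iff)
  also have "\<dots> \<le> (\<Sum>j=m..N. 2 * prob (A j \<inter> B j))"
  proof (rule sum_mono)
    fix j assume "j \<in> {m..N}"
    then show "prob (A j) \<le> 2 * prob (A j \<inter> B j)"
      using mult_left_mono[OF B_half[of j], of "prob (A j)"] by (simp add: AB)
  qed
  also have "\<dots> = 2 * prob (\<Union>j\<in>{m..N}. A j \<inter> B j)"
    using disj by (subst finite_measure_finite_Union)
      (auto simp: sum_distrib_left disjoint_family_on_def)
  also have "\<dots> \<le> 2 * prob {\<omega> \<in> space M. c < \<bar>\<Sum>k=m..<N. X k \<omega>\<bar>}"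
  proof (intro mult_left_mono finite_measure_mono subsetI)
    fix \<omega> assume "\<omega> \<in> (\<Union>j\<in>{m..N}. A j \<inter> B j)"
    then obtain j where j: "m \<le> j" "j \<le> N" "\<omega> \<in> space M"
      "2 * c < \<bar>\<Sum>k=m..<j. X k \<omega>\<bar>" "\<bar>\<Sum>k=j..<N. X k \<omega>\<bar> \<le> c"
      by (auto simp: A_def B_def)
    moreover have "(\<Sum>k=m..<N. X k \<omega>) = (\<Sum>k=m..<j. X k \<omega>) + (\<Sum>k=j..<N. X k \<omega>)"
      using j by (simp add: sum.atLeastLessThan_concat)
    ultimately have "c < \<bar>\<Sum>k=m..<N. X k \<omega>\<bar>" by linarith
    then show "\<omega> \<in> {\<omega> \<in> space M. c < \<bar>\<Sum>k=m..<N. X k \<omega>\<bar>}" using j by simp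
  qed auto
  finally show ?thesis .
qed

text \<open>For independent summands the maximal inequality upgrades the Cauchy property from in
  probability to almost sure: \<open>E c m\<close>, the event that the sums started at m ever leave
  [-2c, 2c], has arbitrarily small probability, so its intersection over m is null. Countably many c
  suffice.\<close>

lemma (in prob_space) AE_summable_indep:
  fixes X :: "nat \<Rightarrow> 'a \<Rightarrow> real"
  assumes indep: "indep_vars (\<lambda>_. borel) X UNIV"
    and cauchy: "\<And>c e. 0 < c \<Longrightarrow> 0 < e \<Longrightarrow>
      \<exists>m. \<forall>j\<ge>m. \<forall>n. prob {\<omega> \<in> space M. c < \<bar>\<Sum>k=j..<n. X k \<omega>\<bar>} \<le> e"
  shows "AE \<omega> in M. summable (\<lambda>k. X k \<omega>)"
proof -
  have [measurable]: "X i \<in> borel_measurable M" for i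
    using indep by (auto simp: indep_vars_def)
  define E where "E c m = {\<omega> \<in> space M. \<exists>j\<ge>m. 2 * c < \<bar>\<Sum>k=m..<j. X k \<omega>\<bar>}" for c m
  have [measurable]: "E c m \<in> events" for c m unfolding E_def by measurable
  have small: "\<exists>m. prob (E c m) \<le> e" if "0 < c" "0 < e" for c e
  proof -
    \<comment> \<open>The bound 1/2 is what the maximal inequality demands of the remainders; e/2
      pays for its factor 2.\<close>
    obtain m where m: "\<And>j n. m \<le> j \<Longrightarrow> prob {\<omega> \<in> space M. c < \<bar>\<Sum>k=j..<n. X k \<omega>\<bar>} \<le> min (1/2) (e/2)"
      using cauchy[OF \<open>0 < c\<close>, of "min (1/2) (e/2)"] \<open>0 < e\<close> by auto
    define F where "F N = {\<omega> \<in> space M. \<exists>j\<in>{m..N}. 2 * c < \<bar>\<Sum>k=m..<j. X k \<omega>\<bar>}" for N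
    have [measurable]: "F N \<in> events" for N unfolding F_def by measurable
    have "(\<lambda>N. prob (F N)) \<longlonglongrightarrow> prob (\<Union>N. F N)"
      by (rule finite_Lim_measure_incseq) (auto simp: F_def incseq_def)
    moreover have "(\<Union>N. F N) = E c m" by (force simp: F_def E_def)
    moreover have "prob (F N) \<le> e" for N
    proof -
      have "prob (F N) \<le> 2 * prob {\<omega> \<in> space M. c < \<bar>\<Sum>k=m..<N. X k \<omega>\<bar>}"
        unfolding F_def by (rule ottaviani_inequality[OF indep]) (use m in fastforce)
      also have "\<dots> \<le> 2 * (e / 2)" using m[of m N] by simp
      finally show ?thesis by simp
    qed
    ultimately have "prob (E c m) \<le> e" by (auto intro: LIMSEQ_le_const2)
    then show ?thesis ..
  qed
  have "AE \<omega> in M. \<exists>m. \<omega> \<notin> E c m" if "0 < c" for c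
  proof -
    have "prob (\<Inter>m. E c m) \<le> e" if "0 < e" for e
    proof -
      obtain m where "prob (E c m) \<le> e" using small[OF \<open>0 < c\<close> \<open>0 < e\<close>] by blast
      moreover have "prob (\<Inter>m. E c m) \<le> prob (E c m)" by (intro finite_measure_mono) auto
      ultimately show ?thesis by simp
    qed
    then have "prob (\<Inter>m. E c m) \<le> 0" by (rule field_le_epsilon) simp
    then have "prob (\<Inter>m. E c m) = 0" using measure_nonneg by (rule antisym)
    then have "AE \<omega> in M. \<omega> \<notin> (\<Inter>m. E c m)" by (subst (asm) prob_eq_0) auto
    then show ?thesis by simp
  qed
  then have "AE \<omega> in M. \<forall>r::nat. \<exists>m. \<omega> \<notin> E (1 / Suc r) m"
    by (subst AE_all_countable) simp
  then show ?thesis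
  proof (rule AE_mp, intro AE_I2 impI)
    fix \<omega> assume \<omega>: "\<omega> \<in> space M" and ex: "\<forall>r::nat. \<exists>m. \<omega> \<notin> E (1 / Suc r) m"
    show "summable (\<lambda>k. X k \<omega>)"
    proof (subst summable_Cauchy, intro allI impI)
      fix e :: real assume "0 < e"
      \<comment> \<open>A block from i to n is a difference of two sums started at m, each at most
        2/(r+1) in modulus, hence the quarter.\<close>
      then obtain r where r: "1 / Suc r < e / 4"
        using reals_Archimedean[of "e / 4"] by (auto simp: inverse_eq_divide)
      obtain m where "\<omega> \<notin> E (1 / Suc r) m" using ex by blast
      then have m: "\<bar>\<Sum>k=m..<j. X k \<omega>\<bar> \<le> 2 * (1 / Suc r)" if "m \<le> j" for j
        using that \<omega> by (auto simp: E_def not_less)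
      show "\<exists>N. \<forall>m\<ge>N. \<forall>n. norm (sum (\<lambda>k. X k \<omega>) {m..<n}) < e"
      proof (intro exI[of _ m] allI impI)
        fix i n assume "m \<le> i"
        show "norm (\<Sum>k=i..<n. X k \<omega>) < e"
        proof (cases "i \<le> n")
          case True
          have "(\<Sum>k=m..<n. X k \<omega>) = (\<Sum>k=m..<i. X k \<omega>) + (\<Sum>k=i..<n. X k \<omega>)"
            using True \<open>m \<le> i\<close> by (simp add: sum.atLeastLessThan_concat)
          then show ?thesis using m[of i] m[of n] r \<open>m \<le> i\<close> True unfolding real_norm_def by linarith
        qed (use \<open>0 < e\<close> in simp)
      qed
    qed
  qed
qed

text \<open>Chebyshev's inequality with a truncated square, suited to variables of infinite
  variance: the integrand equals 1 on the event.\<close>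

lemma (in prob_space) prob_gt_le_expectation_min_one_square:
  assumes [measurable]: "X \<in> borel_measurable M" and "0 < c"
  shows "prob {\<omega> \<in> space M. c < \<bar>X \<omega>\<bar>} \<le> (\<integral>\<omega>. min 1 ((1 / c * X \<omega>)\<^sup>2) \<partial>M)"
proof -
  have "prob {\<omega> \<in> space M. c < \<bar>X \<omega>\<bar>} = (\<integral>\<omega>. indicator {\<omega> \<in> space M. c < \<bar>X \<omega>\<bar>} \<omega> \<partial>M)"
    by simp
  also have "\<dots> \<le> (\<integral>\<omega>. min 1 ((1 / c * X \<omega>)\<^sup>2) \<partial>M)"
  proof (rule integral_mono)
    show "integrable M (\<lambda>\<omega>. min 1 ((1 / c * X \<omega>)\<^sup>2))"
      by (rule integrable_const_bound[where B=1]) auto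
    fix \<omega>
    have "1 \<le> (1 / c * X \<omega>)\<^sup>2" if "c < \<bar>X \<omega>\<bar>"
    proof -
      have "1 \<le> \<bar>1 / c * X \<omega>\<bar>" using that \<open>0 < c\<close> by (simp add: abs_mult)
      then have "1\<^sup>2 \<le> \<bar>1 / c * X \<omega>\<bar>\<^sup>2" by (intro power_mono) auto
      then show ?thesis by (simp only: power2_abs one_power2)
    qed
    then show "indicator {\<omega> \<in> space M. c < \<bar>X \<omega>\<bar>} \<omega> \<le> min 1 ((1 / c * X \<omega>)\<^sup>2)"
      by (auto simp: indicator_def)
    show "integrable M (indicat_real {\<omega> \<in> space M. c < \<bar>X \<omega>\<bar>})"
      by (intro integrable_real_indicator) (auto simp: less_top[symmetric])
  qed
  finally show ?thesis .
qed

text \<open>Stability does the work: a block of the series is again symmetric \<alpha>-stable, with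
  \<kappa> multiplied by the block sum of |a_k|^\<alpha>, so its tail probability is controlled by a
  tail of a convergent series. The law of Z_k is prescribed only where a_k is nonzero, so that a
  differently distributed variable can be masked by a zero coefficient.\<close>

lemma (in prob_space) AE_summable_stable:
  fixes Z :: "nat \<Rightarrow> 'a \<Rightarrow> real" and a :: "nat \<Rightarrow> real"
  assumes indep: "indep_vars (\<lambda>_. borel) Z UNIV" and "0 < \<alpha>" "0 \<le> \<kappa>"
    and char: "\<And>k t. a k \<noteq> 0 \<Longrightarrow> char (distr M borel (Z k)) t = exp (- complex_of_real (\<kappa> * \<bar>t\<bar> powr \<alpha>))"
    and sum: "summable (\<lambda>k. \<bar>a k\<bar> powr \<alpha>)"
  shows "AE \<omega> in M. summable (\<lambda>k. a k * Z k \<omega>)"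
proof (rule AE_summable_indep)
  have [measurable]: "Z i \<in> borel_measurable M" for i
    using indep by (auto simp: indep_vars_def)
  show ind: "indep_vars (\<lambda>_. borel) (\<lambda>k \<omega>. a k * Z k \<omega>) UNIV"
    by (rule indep_vars_compose2[OF indep]) auto
  fix c e :: real assume "0 < c" "0 < e"
  define C where "C = moment_const \<alpha> * \<kappa> * \<bar>1 / c\<bar> powr \<alpha> + 1"
  have C: "0 < C" using \<open>0 \<le> \<kappa>\<close> moment_const_nonneg[OF \<open>0 < \<alpha>\<close>]
    by (auto simp: C_def intro!: add_nonneg_pos mult_nonneg_nonneg)
  obtain m where m: "\<And>j n. m \<le> j \<Longrightarrow> \<bar>\<Sum>k=j..<n. \<bar>a k\<bar> powr \<alpha>\<bar> < e / C"
    using sum \<open>0 < e\<close> C unfolding summable_Cauchy real_norm_def by (meson divide_pos_pos)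
  show "\<exists>m. \<forall>j\<ge>m. \<forall>n. prob {\<omega> \<in> space M. c < \<bar>\<Sum>k=j..<n. a k * Z k \<omega>\<bar>} \<le> e"
  proof (intro exI[of _ m] allI impI)
    fix j n assume "m \<le> j"
    define s where "s = (\<Sum>k=j..<n. \<bar>a k\<bar> powr \<alpha>)"
    have s: "0 \<le> s" "s < e / C" using m[OF \<open>m \<le> j\<close>, of n] by (auto simp: s_def sum_nonneg)
    have char': "char (distr M borel (\<lambda>\<omega>. \<Sum>k=j..<n. a k * Z k \<omega>)) t
        = exp (- complex_of_real (\<kappa> * s * \<bar>t\<bar> powr \<alpha>))" for t
    proof -
      have "char (distr M borel (\<lambda>\<omega>. \<Sum>k=j..<n. a k * Z k \<omega>)) t
        = (\<Prod>k=j..<n. char (distr M borel (\<lambda>\<omega>. a k * Z k \<omega>)) t)"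
        by (rule char_distr_sum) (rule indep_vars_subset[OF ind], simp)
      also have "\<dots> = (\<Prod>k=j..<n. exp (- complex_of_real (\<kappa> * \<bar>t * a k\<bar> powr \<alpha>)))"
      proof (rule prod.cong[OF refl])
        fix k
        have "char (distr M borel (\<lambda>\<omega>. a k * Z k \<omega>)) t = char (distr M borel (Z k)) (t * a k)"
          by (simp add: char_def integral_distr mult.assoc)
        also have "\<dots> = exp (- complex_of_real (\<kappa> * \<bar>t * a k\<bar> powr \<alpha>))"
        proof (cases "a k = 0")
          case True
          interpret D: real_distribution "distr M borel (Z k)" by (rule real_distribution_distr) simp
          show ?thesis using True by (simp add: D.char_zero)
        qed (simp add: char)
        finally show "char (distr M borel (\<lambda>\<omega>. a k * Z k \<omega>)) t = \<dots>" .
      qed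
      also have "\<dots> = exp (\<Sum>k=j..<n. - complex_of_real (\<kappa> * \<bar>t * a k\<bar> powr \<alpha>))"
        by (simp add: exp_sum)
      also have "(\<Sum>k=j..<n. - complex_of_real (\<kappa> * \<bar>t * a k\<bar> powr \<alpha>)) = - complex_of_real (\<kappa> * s * \<bar>t\<bar> powr \<alpha>)"
        by (simp add: s_def abs_mult powr_mult sum_negf sum_distrib_left sum_distrib_right mult_ac)
      finally show ?thesis .
    qed
    have "prob {\<omega> \<in> space M. c < \<bar>\<Sum>k=j..<n. a k * Z k \<omega>\<bar>}
        \<le> (\<integral>\<omega>. min 1 ((1 / c * (\<Sum>k=j..<n. a k * Z k \<omega>))\<^sup>2) \<partial>M)"
      by (rule prob_gt_le_expectation_min_one_square) (use \<open>0 < c\<close> in auto)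
    also have "\<dots> \<le> moment_const \<alpha> * (\<kappa> * s * \<bar>1 / c\<bar> powr \<alpha>)"
      by (rule expectation_min_one_square_scaled_le) (use s char' assms in auto)
    also have "\<dots> \<le> C * s" using s by (simp add: C_def algebra_simps)
    also have "\<dots> \<le> e" using s C by (simp add: field_simps)
    finally show "prob {\<omega> \<in> space M. c < \<bar>\<Sum>k=j..<n. a k * Z k \<omega>\<bar>} \<le> e" .
  qed
qed

text \<open>With zero skewness and shift the cases of index 1 and of index different from 1 give the
  same formula.\<close>

lemma stable_charfun_symmetric:
  assumes "0 < \<sigma>"
  shows "stable_charfun \<alpha> \<sigma> 0 0 t = exp (- complex_of_real (\<sigma> powr \<alpha> * \<bar>t\<bar> powr \<alpha>))"
  using assms by (simp add: stable_charfun_def)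

subsection \<open>Convergence in distribution\<close>

text \<open>A bounded continuous function is the increasing limit of the Lipschitz functions
  \<open>g k x = (INF y. f y + k * dist x y)\<close>, which yields the lower bound for the liminf; applied to
  \<open>- f\<close> it yields the upper bound for the limsup.\<close>

lemma (in prob_space) conv_distr_lipschitzI:
  fixes U :: "nat \<Rightarrow> 'a \<Rightarrow> 'b::metric_space" and V :: "'a \<Rightarrow> 'b"
  assumes U[measurable]: "\<And>n. U n \<in> borel_measurable M" and V[measurable]: "V \<in> borel_measurable M"
    and lip: "\<And>(f :: 'b \<Rightarrow> real) L B. (\<And>x y. \<bar>f x - f y\<bar> \<le> L * dist x y) \<Longrightarrow> (\<And>x. \<bar>f x\<bar> \<le> B)
      \<Longrightarrow> (\<lambda>n. \<integral>\<omega>. f (U n \<omega>) \<partial>M) \<longlonglongrightarrow> (\<integral>\<omega>. f (V \<omega>) \<partial>M)"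
  shows "conv_distr M U V"
proof -
  have lower: "eventually (\<lambda>n. (\<integral>\<omega>. f (V \<omega>) \<partial>M) - e < (\<integral>\<omega>. f (U n \<omega>) \<partial>M)) sequentially"
    if cont: "continuous_on UNIV f" and B: "\<And>x. \<bar>f x\<bar> \<le> B" and "0 < e" for f :: "'b \<Rightarrow> real" and B e
  proof -
    have f[measurable]: "f \<in> borel_measurable borel" by (rule borel_measurable_continuous_onI[OF cont])
    define g where "g k x = (INF y. f y + real k * dist x y)" for k x
    have lb: "- B \<le> f y + real k * dist x y" for k x y
      using B[of y] by (intro add_increasing2) auto
    have bdd: "bdd_below (range (\<lambda>y. f y + real k * dist x y))" for k x
      using lb by (intro bdd_belowI2)
    have g_ge: "- B \<le> g k x" for k x unfolding g_def by (rule cINF_greatest) (auto intro: lb)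
    have g_le: "g k x \<le> f y + real k * dist x y" for k x y
      unfolding g_def by (rule cINF_lower[OF bdd]) simp
    have g_le_f: "g k x \<le> f x" for k x using g_le[of k x x] by simp
    have g_lip1: "g k x - g k y \<le> real k * dist x y" for k x y
    proof -
      have "g k x - real k * dist x y \<le> g k y"
        unfolding g_def[of k y]
      proof (rule cINF_greatest)
        fix z
        have "real k * dist x z \<le> real k * (dist x y + dist y z)"
          by (intro mult_left_mono dist_triangle) auto
        then show "g k x - real k * dist x y \<le> f z + real k * dist y z"
          using g_le[of k x z] by (simp add: algebra_simps)
      qed simp
      then show ?thesis by simp
    qed
    have g_lip: "\<bar>g k x - g k y\<bar> \<le> real k * dist x y" for k x y
      using g_lip1[of k x y] g_lip1[of k y x] by (simp add: abs_le_iff dist_commute)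
    have g_abs: "\<bar>g k x\<bar> \<le> B" for k x
      using g_ge[of k x] g_le_f[of k x] B[of x] by linarith
    have g_meas[measurable]: "g k \<in> borel_measurable borel" for k
    proof (rule borel_measurable_continuous_onI)
      have "(real k)-lipschitz_on UNIV (g k)"
        by (rule lipschitz_onI) (use g_lip in \<open>auto simp: dist_real_def\<close>)
      then show "continuous_on UNIV (g k)" by (rule lipschitz_on_continuous_on)
    qed
    have g_lim: "(\<lambda>k. g k x) \<longlonglongrightarrow> f x" for x
    proof (rule LIMSEQ_I)
      fix r :: real assume "0 < r"
      have "isCont f x" using cont by (simp add: continuous_on_eq_continuous_at)
      then obtain d where d: "0 < d" "\<And>y. dist y x < d \<Longrightarrow> dist (f y) (f x) < r / 2"
        using \<open>0 < r\<close> unfolding continuous_at_eps_delta by (meson half_gt_zero)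
      \<comment> \<open>At distance d or more the penalty k d is at least 2B, the largest possible
        oscillation of f, so only points near x can matter in the infimum.\<close>
      obtain k0 :: nat where k0: "2 * B / d \<le> real k0" using real_arch_simple by blast
      show "\<exists>no. \<forall>k\<ge>no. norm (g k x - f x) < r"
      proof (intro exI[of _ k0] allI impI)
        fix k assume "k0 \<le> k"
        have "f x - r / 2 \<le> g k x"
          unfolding g_def
        proof (rule cINF_greatest)
          fix y
          show "f x - r / 2 \<le> f y + real k * dist x y"
          proof (cases "dist y x < d")
            case True
            then have "f x - r / 2 \<le> f y" using d(2)[of y] unfolding dist_real_def by linarith
            then show ?thesis by (simp add: add_increasing2)
          next
            case False
            have "2 * B \<le> real k * d" using k0 d \<open>k0 \<le> k\<close>
              by (smt (verit) divide_le_eq of_nat_mono mult_right_mono)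
            also have "\<dots> \<le> real k * dist x y" using False by (intro mult_left_mono) (auto simp: dist_commute)
            finally show ?thesis using B[of x] B[of y] \<open>0 < r\<close> by linarith
          qed
        qed simp
        then show "norm (g k x - f x) < r" using g_le_f[of k x] \<open>0 < r\<close> unfolding real_norm_def by linarith
      qed
    qed
    have "(\<lambda>k. \<integral>\<omega>. g k (V \<omega>) \<partial>M) \<longlonglongrightarrow> (\<integral>\<omega>. f (V \<omega>) \<partial>M)"
      by (rule integral_dominated_convergence[where w="\<lambda>_. B"]) (auto intro!: g_lim g_abs)
    then have "eventually (\<lambda>k. (\<integral>\<omega>. f (V \<omega>) \<partial>M) - e / 2 < (\<integral>\<omega>. g k (V \<omega>) \<partial>M)) sequentially"
      using \<open>0 < e\<close> by (intro order_tendstoD) auto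
    then obtain k where k: "(\<integral>\<omega>. f (V \<omega>) \<partial>M) - e / 2 < (\<integral>\<omega>. g k (V \<omega>) \<partial>M)"
      by (auto simp: eventually_sequentially)
    have "(\<lambda>n. \<integral>\<omega>. g k (U n \<omega>) \<partial>M) \<longlonglongrightarrow> (\<integral>\<omega>. g k (V \<omega>) \<partial>M)"
      by (rule lip[OF g_lip g_abs])
    then have "eventually (\<lambda>n. (\<integral>\<omega>. g k (V \<omega>) \<partial>M) - e / 2 < (\<integral>\<omega>. g k (U n \<omega>) \<partial>M)) sequentially"
      using \<open>0 < e\<close> by (intro order_tendstoD) auto
    then show ?thesis
    proof (rule eventually_mono)
      fix n assume "(\<integral>\<omega>. g k (V \<omega>) \<partial>M) - e / 2 < (\<integral>\<omega>. g k (U n \<omega>) \<partial>M)"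
      moreover have "(\<integral>\<omega>. g k (U n \<omega>) \<partial>M) \<le> (\<integral>\<omega>. f (U n \<omega>) \<partial>M)"
        by (intro integral_mono integrable_const_bound[where B=B]) (auto intro: g_le_f g_abs B)
      ultimately show "(\<integral>\<omega>. f (V \<omega>) \<partial>M) - e < (\<integral>\<omega>. f (U n \<omega>) \<partial>M)" using k by linarith
    qed
  qed
  show ?thesis
    unfolding conv_distr_def
  proof (intro allI impI)
    fix f :: "'b \<Rightarrow> real" assume cont: "continuous_on UNIV f" and "bounded (range f)"
    then obtain B where B: "\<And>x. \<bar>f x\<bar> \<le> B" by (auto simp: bounded_iff)
    show "(\<lambda>n. \<integral>\<omega>. f (U n \<omega>) \<partial>M) \<longlonglongrightarrow> (\<integral>\<omega>. f (V \<omega>) \<partial>M)"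
    proof (rule tendstoI)
      fix e :: real assume "0 < e"
      show "eventually (\<lambda>n. dist (\<integral>\<omega>. f (U n \<omega>) \<partial>M) (\<integral>\<omega>. f (V \<omega>) \<partial>M) < e) sequentially"
        using lower[OF cont B \<open>0 < e\<close>] lower[of "\<lambda>x. - f x" B e] cont B \<open>0 < e\<close>
        by (auto simp: dist_real_def continuous_on_minus elim: eventually_elim2)
    qed
  qed
qed

text \<open>A three-term estimate: U n is close to Um m n, which converges to Vm m as n grows, which
  in turn approaches V. The closeness is required in the order limit in m of limit superior in n,
  and \<open>min 1 dist\<close> measures it in probability. Testing only Lipschitz functions
  converts it into closeness of integrals.\<close>

lemma (in prob_space) conv_distr_approximation:
  fixes U :: "nat \<Rightarrow> 'a \<Rightarrow> 'b::{metric_space, second_countable_topology}" and V :: "'a \<Rightarrow> 'b"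
  assumes U[measurable]: "\<And>n. U n \<in> borel_measurable M" and V[measurable]: "V \<in> borel_measurable M"
    and Um[measurable]: "\<And>m n. Um m n \<in> borel_measurable M"
    and Vm[measurable]: "\<And>m. Vm m \<in> borel_measurable M"
    and conv: "\<And>m. conv_distr M (Um m) (Vm m)"
    and lim: "AE \<omega> in M. (\<lambda>m. Vm m \<omega>) \<longlonglongrightarrow> V \<omega>"
    and approx: "\<And>e. 0 < e \<Longrightarrow> \<exists>m0. \<forall>m\<ge>m0.
      eventually (\<lambda>n. (\<integral>\<omega>. min 1 (dist (U n \<omega>) (Um m n \<omega>)) \<partial>M) \<le> e) sequentially"
  shows "conv_distr M U V"
proof (rule conv_distr_lipschitzI[OF U V])
  fix f :: "'b \<Rightarrow> real" and L B
  assume lip': "\<And>x y. \<bar>f x - f y\<bar> \<le> L * dist x y" and B: "\<And>x. \<bar>f x\<bar> \<le> B"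
  have lip: "\<bar>f x - f y\<bar> \<le> \<bar>L\<bar> * dist x y" for x y
    using lip'[of x y] mult_right_mono[OF abs_ge_self[of L], of "dist x y"] by simp
  then have "\<bar>L\<bar>-lipschitz_on UNIV f"
    by (intro lipschitz_onI) (auto simp: dist_real_def)
  then have cont: "continuous_on UNIV f" by (rule lipschitz_on_continuous_on)
  then have f[measurable]: "f \<in> borel_measurable borel" by (rule borel_measurable_continuous_onI)
  have B0: "0 \<le> B" using B[of undefined] by linarith
  \<comment> \<open>The Lipschitz constant handles distances up to 1, the bound 2B larger ones; the
    1 keeps \<open>K\<close> positive for the division below.\<close>
  define K where "K = \<bar>L\<bar> + 2 * B + 1"
  have K: "0 < K" using B0 by (simp add: K_def)
  have int[simp]: "integrable M (\<lambda>\<omega>. f (G \<omega>))" if "G \<in> borel_measurable M" for G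
    by (rule integrable_const_bound[where B=B]) (use B that in auto)
  have fK: "\<bar>f x - f y\<bar> \<le> K * min 1 (dist x y)" for x y
  proof (cases "dist x y \<le> 1")
    case True
    then show ?thesis using order_trans[OF lip[of x y] mult_right_mono[of "\<bar>L\<bar>" K]] B0 by (simp add: K_def)
  next
    case False
    then show ?thesis using B[of x] B[of y] B0 by (simp add: K_def)
  qed
  have bnd: "bounded (range f)" using B by (auto simp: bounded_iff)
  show "(\<lambda>n. \<integral>\<omega>. f (U n \<omega>) \<partial>M) \<longlonglongrightarrow> (\<integral>\<omega>. f (V \<omega>) \<partial>M)"
  proof (rule tendstoI)
    fix e :: real assume "0 < e"
    then obtain m0 where m0: "\<And>m. m0 \<le> m \<Longrightarrow>
       eventually (\<lambda>n. (\<integral>\<omega>. min 1 (dist (U n \<omega>) (Um m n \<omega>)) \<partial>M) \<le> e / (3 * K)) sequentially"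
      using approx[of "e / (3 * K)"] K by auto
    have "(\<lambda>m. \<integral>\<omega>. f (Vm m \<omega>) \<partial>M) \<longlonglongrightarrow> (\<integral>\<omega>. f (V \<omega>) \<partial>M)"
    proof (rule integral_dominated_convergence[where w="\<lambda>_. B"])
      show "AE \<omega> in M. (\<lambda>m. f (Vm m \<omega>)) \<longlonglongrightarrow> f (V \<omega>)"
        using lim
      proof (rule AE_mp, intro AE_I2 impI)
        fix \<omega> assume "(\<lambda>m. Vm m \<omega>) \<longlonglongrightarrow> V \<omega>"
        then show "(\<lambda>m. f (Vm m \<omega>)) \<longlonglongrightarrow> f (V \<omega>)"
          using cont by (intro isCont_tendsto_compose[of _ f]) (auto simp: continuous_on_eq_continuous_at)
      qed
    qed (use B in auto)
    then have "eventually (\<lambda>m. dist (\<integral>\<omega>. f (Vm m \<omega>) \<partial>M) (\<integral>\<omega>. f (V \<omega>) \<partial>M) < e / 3) sequentially"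
      using \<open>0 < e\<close> by (intro tendstoD) auto
    then have "eventually (\<lambda>m. m0 \<le> m \<and> dist (\<integral>\<omega>. f (Vm m \<omega>) \<partial>M) (\<integral>\<omega>. f (V \<omega>) \<partial>M) < e / 3) sequentially"
      using eventually_ge_at_top[of m0] by (rule eventually_elim2) auto
    then obtain m where m: "m0 \<le> m" "dist (\<integral>\<omega>. f (Vm m \<omega>) \<partial>M) (\<integral>\<omega>. f (V \<omega>) \<partial>M) < e / 3"
      by (auto simp: eventually_sequentially)
    have "(\<lambda>n. \<integral>\<omega>. f (Um m n \<omega>) \<partial>M) \<longlonglongrightarrow> (\<integral>\<omega>. f (Vm m \<omega>) \<partial>M)"
      using conv[of m] cont bnd by (auto simp: conv_distr_def)
    then have "eventually (\<lambda>n. dist (\<integral>\<omega>. f (Um m n \<omega>) \<partial>M) (\<integral>\<omega>. f (Vm m \<omega>) \<partial>M) < e / 3) sequentially"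
      using \<open>0 < e\<close> by (intro tendstoD) auto
    then show "eventually (\<lambda>n. dist (\<integral>\<omega>. f (U n \<omega>) \<partial>M) (\<integral>\<omega>. f (V \<omega>) \<partial>M) < e) sequentially"
      using m0[OF m(1)]
    proof (rule eventually_elim2)
      fix n
      assume n: "dist (\<integral>\<omega>. f (Um m n \<omega>) \<partial>M) (\<integral>\<omega>. f (Vm m \<omega>) \<partial>M) < e / 3"
        and le: "(\<integral>\<omega>. min 1 (dist (U n \<omega>) (Um m n \<omega>)) \<partial>M) \<le> e / (3 * K)"
      have "\<bar>(\<integral>\<omega>. f (U n \<omega>) \<partial>M) - (\<integral>\<omega>. f (Um m n \<omega>) \<partial>M)\<bar> = \<bar>\<integral>\<omega>. f (U n \<omega>) - f (Um m n \<omega>) \<partial>M\<bar>"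
        by simp
      also have "\<dots> \<le> (\<integral>\<omega>. \<bar>f (U n \<omega>) - f (Um m n \<omega>)\<bar> \<partial>M)" by (rule integral_abs_bound)
      also have "\<dots> \<le> (\<integral>\<omega>. K * min 1 (dist (U n \<omega>) (Um m n \<omega>)) \<partial>M)"
        using fK by (intro integral_mono integrable_mult_right integrable_abs Bochner_Integration.integrable_diff)
          (auto intro: integrable_const_bound[where B=1])
      also have "\<dots> = K * (\<integral>\<omega>. min 1 (dist (U n \<omega>) (Um m n \<omega>)) \<partial>M)" by simp
      also have "\<dots> \<le> K * (e / (3 * K))" using le K by (intro mult_left_mono) auto
      also have "\<dots> = e / 3" using K by simp
      finally show "dist (\<integral>\<omega>. f (U n \<omega>) \<partial>M) (\<integral>\<omega>. f (V \<omega>) \<partial>M) < e"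
        using n m(2) unfolding dist_real_def by linarith
    qed
  qed
qed

section \<open>Absence of an atom at 0, continuous maps and quotients\<close>

text \<open>A Fejer-type kernel \<open>\<bar>\<Sum>k<N. exp (\<i> k L X)\<bar>\<^sup>2\<close> equals \<open>N\<^sup>2\<close> on \<open>{X = 0}\<close>; for \<open>L\<close> large its
  expectation is essentially the diagonal \<open>N\<close>.\<close>

lemma (in prob_space) prob_eq_0_of_char_decay:
  assumes [measurable]: "X \<in> borel_measurable M" and "0 < c" "0 < a"
    and decay: "\<And>t. norm (char (distr M borel X) t) \<le> exp (- (c * \<bar>t\<bar> powr a))"
  shows "prob {\<omega> \<in> space M. X \<omega> = 0} = 0"
proof -
  have bound: "prob {\<omega> \<in> space M. X \<omega> = 0} \<le> 2 / real N" if "2 \<le> N" for N :: nat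
  proof -
    \<comment> \<open>Chosen so that c L^a = ln N. As |k - l| is at least 1 off the diagonal, each
      off-diagonal expectation is then at most 1/N.\<close>
    define L where "L = (ln (real N) / c) powr (1 / a)"
    have lnN: "0 < ln (real N)" using that by simp
    have L: "0 < L" "c * L powr a = ln (real N)"
      using lnN \<open>0 < c\<close> \<open>0 < a\<close> by (auto simp: L_def powr_powr)
    define D where "D \<omega> = (\<Sum>k<N. \<Sum>l<N. cos ((real k - real l) * L * X \<omega>))" for \<omega>
    have D_eq: "D \<omega> = (\<Sum>k<N. cos (real k * L * X \<omega>))\<^sup>2 + (\<Sum>k<N. sin (real k * L * X \<omega>))\<^sup>2" for \<omega>
      by (simp add: D_def power2_eq_square sum_product cos_diff left_diff_distrib sum.distrib)
    have cos_int[simp]: "integrable M (\<lambda>\<omega>. cos (t * X \<omega>))" for t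
      by (rule integrable_const_bound[where B=1]) auto
    have D_int: "integrable M D" unfolding D_def
      by (intro Bochner_Integration.integrable_sum cos_int)
    have E_cos: "(\<integral>\<omega>. cos (t * X \<omega>) \<partial>M) \<le> exp (- (c * \<bar>t\<bar> powr a))" for t
    proof -
      have "(\<integral>\<omega>. cos (t * X \<omega>) \<partial>M) = Re (char (distr M borel X) t)"
        using integral_one_minus_cos[OF assms(1), of t] by (simp add: prob_space)
      also have "\<dots> \<le> norm (char (distr M borel X) t)" by (rule complex_Re_le_cmod)
      finally show ?thesis using decay[of t] by linarith
    qed
    have "(real N)\<^sup>2 * prob {\<omega> \<in> space M. X \<omega> = 0}
        = (\<integral>\<omega>. (real N)\<^sup>2 * indicator {\<omega> \<in> space M. X \<omega> = 0} \<omega> \<partial>M)" by simp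
    also have "\<dots> \<le> (\<integral>\<omega>. D \<omega> \<partial>M)"
    proof (rule integral_mono[OF _ D_int])
      fix \<omega>
      show "(real N)\<^sup>2 * indicator {\<omega> \<in> space M. X \<omega> = 0} \<omega> \<le> D \<omega>"
        by (cases "X \<omega> = 0") (auto simp: D_eq indicator_def)
      show "integrable M (\<lambda>\<omega>. (real N)\<^sup>2 * indicator {\<omega> \<in> space M. X \<omega> = 0} \<omega>)"
        by (intro integrable_mult_right integrable_real_indicator) (auto simp: less_top[symmetric])
    qed
    also have "\<dots> = (\<Sum>k<N. \<Sum>l<N. \<integral>\<omega>. cos ((real k - real l) * L * X \<omega>) \<partial>M)"
      unfolding D_def by (subst Bochner_Integration.integral_sum; simp add: Bochner_Integration.integral_sum)
    also have "\<dots> \<le> (\<Sum>k<N. \<Sum>l<N. (if l = k then 1 else 0) + 1 / real N)"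
    proof (intro sum_mono)
      fix k l
      show "(\<integral>\<omega>. cos ((real k - real l) * L * X \<omega>) \<partial>M) \<le> (if l = k then 1 else 0) + 1 / real N"
      proof (cases "l = k")
        case True then show ?thesis by (simp add: prob_space)
      next
        case False
        then have "1 \<le> \<bar>real k - real l\<bar>" by linarith
        then have "L \<le> \<bar>(real k - real l) * L\<bar>"
          using L mult_right_mono[of 1 "\<bar>real k - real l\<bar>" L] by (simp add: abs_mult)
        then have "L powr a \<le> \<bar>(real k - real l) * L\<bar> powr a"
          using L \<open>0 < a\<close> by (intro powr_mono2) auto
        then have "ln (real N) \<le> c * \<bar>(real k - real l) * L\<bar> powr a"
          unfolding L(2)[symmetric] using \<open>0 < c\<close> by (intro mult_left_mono) auto
        then have "exp (- (c * \<bar>(real k - real l) * L\<bar> powr a)) \<le> exp (- ln (real N))" by simp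
        also have "\<dots> = 1 / real N" using that by (simp add: exp_minus inverse_eq_divide)
        finally show ?thesis using E_cos[of "(real k - real l) * L"] False by simp
      qed
    qed
    \<comment> \<open>The diagonal gives N and the N^2 entries 1/N give another N; dividing by N^2
      bounds the atom by 2/N.\<close>
    also have "\<dots> = 2 * real N" using that by (simp add: sum.distrib)
    finally show ?thesis using that by (simp add: field_simps power2_eq_square)
  qed
  have "(\<lambda>N. 2 / real N) \<longlonglongrightarrow> 0" by (rule lim_const_over_n)
  then have "prob {\<omega> \<in> space M. X \<omega> = 0} \<le> 0"
    by (rule LIMSEQ_le_const) (use bound in blast)
  then show ?thesis using measure_nonneg by (rule antisym)
qed

lemma conv_distr_continuous_map:
  assumes "conv_distr M U V" "continuous_on UNIV g"
  shows "conv_distr M (\<lambda>n \<omega>. g (U n \<omega>)) (\<lambda>\<omega>. g (V \<omega>))"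
  unfolding conv_distr_def
proof (intro allI impI)
  fix f :: "'c \<Rightarrow> real" assume f: "continuous_on UNIV f" "bounded (range f)"
  have "continuous_on UNIV (\<lambda>x. f (g x))"
    by (rule continuous_on_compose2[OF f(1) assms(2)]) auto
  moreover have "bounded (range (\<lambda>x. f (g x)))"
    by (rule bounded_subset[OF f(2)]) auto
  ultimately show "(\<lambda>n. \<integral>\<omega>. f (g (U n \<omega>)) \<partial>M) \<longlonglongrightarrow> (\<integral>\<omega>. f (g (V \<omega>)) \<partial>M)"
    using assms(1) unfolding conv_distr_def by blast
qed

lemma conv_distr_cong:
  assumes "eventually (\<lambda>n. \<forall>\<omega>. U n \<omega> = U' n \<omega>) sequentially" "conv_distr M U V"
  shows "conv_distr M U' V"
  unfolding conv_distr_def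
proof (intro allI impI)
  fix f :: "'b \<Rightarrow> real" assume "continuous_on UNIV f" "bounded (range f)"
  then have "(\<lambda>n. \<integral>\<omega>. f (U n \<omega>) \<partial>M) \<longlonglongrightarrow> (\<integral>\<omega>. f (V \<omega>) \<partial>M)"
    using assms(2) by (auto simp: conv_distr_def)
  moreover have "eventually (\<lambda>n. (\<integral>\<omega>. f (U n \<omega>) \<partial>M) = (\<integral>\<omega>. f (U' n \<omega>) \<partial>M)) sequentially"
    using assms(1) by (rule eventually_mono) simp
  ultimately show "(\<lambda>n. \<integral>\<omega>. f (U' n \<omega>) \<partial>M) \<longlonglongrightarrow> (\<integral>\<omega>. f (V \<omega>) \<partial>M)"
    by (rule Lim_transform_eventually)
qed

text \<open>The quotient is discontinuous where the denominator vanishes; \<open>\<phi>\<close> cuts out a neighbourhood of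
  that set, off which the quotient agrees with a globally continuous map.\<close>

lemma (in prob_space) conv_distr_ratio:
  fixes U :: "nat \<Rightarrow> 'a \<Rightarrow> nat \<Rightarrow> real" and V :: "'a \<Rightarrow> nat \<Rightarrow> real"
  assumes U[measurable]: "\<And>n j. (\<lambda>\<omega>. U n \<omega> j) \<in> borel_measurable M"
    and V[measurable]: "\<And>j. (\<lambda>\<omega>. V \<omega> j) \<in> borel_measurable M"
    and conv: "conv_distr M U V" and nz: "AE \<omega> in M. V \<omega> 0 \<noteq> 0"
  shows "conv_distr M (\<lambda>n \<omega> j. if j < r then U n \<omega> (Suc j) / U n \<omega> 0 else 0)
    (\<lambda>\<omega> j. if j < (r::nat) then V \<omega> (Suc j) / V \<omega> 0 else 0)"
proof -
  define h where "h x j = (if j < r then x (Suc j) / x 0 else 0)" for x :: "nat \<Rightarrow> real" and j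
  \<comment> \<open>Writing the quotient as x_(j+1) x_0 / x_0^2 lets the maximum bound the
    denominator below without touching the sign of x_0.\<close>
  define H where "H \<eta> x j = (if j < r then x (Suc j) * x 0 / max ((x 0)\<^sup>2) ((\<eta> / 2)\<^sup>2) else 0)"
    for \<eta> and x :: "nat \<Rightarrow> real" and j
  \<comment> \<open>Piecewise linear: 0 for |w| \<le> \<eta>/2 and 1 for |w| \<ge> \<eta>. Its
    support lies where the maximum in \<open>H\<close> is x_0^2.\<close>
  define \<phi> where "\<phi> \<eta> w = max 0 (min 1 (2 * \<bar>w\<bar> / \<eta> - 1))" for \<eta> w :: real
  have hm[measurable]: "(\<lambda>\<omega>. h (G \<omega>)) \<in> borel_measurable M"
    if [measurable]: "\<And>j. (\<lambda>\<omega>. G \<omega> j) \<in> borel_measurable M" for G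
    by (rule measurable_coordinatewise_then_product) (simp add: h_def)
  have \<phi>m[measurable]: "\<phi> \<eta> \<in> borel_measurable borel" for \<eta> unfolding \<phi>_def by measurable
  have \<phi>01: "0 \<le> \<phi> \<eta> w" "\<phi> \<eta> w \<le> 1" for \<eta> w by (auto simp: \<phi>_def)
  have Hh: "H \<eta> x = h x" if "\<phi> \<eta> (x 0) \<noteq> 0" "0 < \<eta>" for \<eta> x
  proof -
    have "1 \<le> 2 * \<bar>x 0\<bar> / \<eta>" using that(1) unfolding \<phi>_def by linarith
    from iffD1[OF pos_le_divide_eq[OF \<open>0 < \<eta>\<close>] this] have "1 * \<eta> \<le> 2 * \<bar>x 0\<bar>" .
    then have le: "\<eta> / 2 \<le> \<bar>x 0\<bar>" by simp
    then have "(\<eta> / 2)\<^sup>2 \<le> \<bar>x 0\<bar>\<^sup>2" using \<open>0 < \<eta>\<close> by (intro power_mono) auto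
    then show ?thesis using le \<open>0 < \<eta>\<close> by (auto simp: H_def h_def fun_eq_iff power2_eq_square)
  qed
  have "conv_distr M (\<lambda>n \<omega>. h (U n \<omega>)) (\<lambda>\<omega>. h (V \<omega>))"
    unfolding conv_distr_def
  proof (intro allI impI)
    fix f :: "(nat \<Rightarrow> real) \<Rightarrow> real" assume f: "continuous_on UNIV f" "bounded (range f)"
    have fm[measurable]: "f \<in> borel_measurable borel" by (rule borel_measurable_continuous_onI[OF f(1)])
    obtain B' where B': "\<And>x. \<bar>f x\<bar> \<le> B'" using f(2) by (auto simp: bounded_iff)
    define B where "B = B' + 1"
    have B: "\<bar>f x\<bar> \<le> B" for x using B'[of x] by (simp add: B_def)
    have B0: "0 < B" using B'[of undefined] by (simp add: B_def)
    have int_f[simp]: "integrable M (\<lambda>\<omega>. f (h (G \<omega>)))"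
      if [measurable]: "\<And>j. (\<lambda>\<omega>. G \<omega> j) \<in> borel_measurable M" for G
      by (rule integrable_const_bound[where B=B]) (use B in auto)
    have int_\<phi>[simp]: "integrable M (\<lambda>\<omega>. \<phi> \<eta> (g \<omega>))" if [measurable]: "g \<in> borel_measurable M" for \<eta> g
      by (rule integrable_const_bound[where B=1]) (use \<phi>01 in auto)
    have int_f\<phi>[simp]: "integrable M (\<lambda>\<omega>. f (h (G \<omega>)) * \<phi> \<eta> (G \<omega> 0))"
      if [measurable]: "\<And>j. (\<lambda>\<omega>. G \<omega> j) \<in> borel_measurable M" for G \<eta>
    proof (rule integrable_const_bound[where B="B * 1"])
      have "\<bar>f x * \<phi> \<eta> y\<bar> \<le> B * 1" for x y
        unfolding abs_mult using B[of x] \<phi>01[of \<eta> y] B0 by (intro mult_mono) auto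
      then show "AE \<omega> in M. norm (f (h (G \<omega>)) * \<phi> \<eta> (G \<omega> 0)) \<le> B * 1" by simp
    qed measurable
    \<comment> \<open>Inserting the cutoff costs at most B times the expected loss 1 - \<phi>, for
      every U n and for V alike.\<close>
    have cut: "\<bar>(\<integral>\<omega>. f (h (G \<omega>)) \<partial>M) - (\<integral>\<omega>. f (h (G \<omega>)) * \<phi> \<eta> (G \<omega> 0) \<partial>M)\<bar>
        \<le> B * (1 - (\<integral>\<omega>. \<phi> \<eta> (G \<omega> 0) \<partial>M))"
      if G[measurable]: "\<And>j. (\<lambda>\<omega>. G \<omega> j) \<in> borel_measurable M" for G \<eta>
    proof -
      have "(\<integral>\<omega>. f (h (G \<omega>)) \<partial>M) - (\<integral>\<omega>. f (h (G \<omega>)) * \<phi> \<eta> (G \<omega> 0) \<partial>M)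
          = (\<integral>\<omega>. f (h (G \<omega>)) - f (h (G \<omega>)) * \<phi> \<eta> (G \<omega> 0) \<partial>M)"
        using G by simp
      also have "\<bar>\<dots>\<bar> \<le> (\<integral>\<omega>. \<bar>f (h (G \<omega>)) - f (h (G \<omega>)) * \<phi> \<eta> (G \<omega> 0)\<bar> \<partial>M)"
        by (rule integral_abs_bound)
      also have "\<dots> \<le> (\<integral>\<omega>. B * (1 - \<phi> \<eta> (G \<omega> 0)) \<partial>M)"
      proof (rule integral_mono)
        fix \<omega>
        have "\<bar>f (h (G \<omega>)) - f (h (G \<omega>)) * \<phi> \<eta> (G \<omega> 0)\<bar> = \<bar>f (h (G \<omega>))\<bar> * \<bar>1 - \<phi> \<eta> (G \<omega> 0)\<bar>"
          by (simp add: right_diff_distrib flip: abs_mult)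
        also have "\<dots> \<le> B * (1 - \<phi> \<eta> (G \<omega> 0))"
          using B[of "h (G \<omega>)"] \<phi>01[of \<eta> "G \<omega> 0"] B0 by (intro mult_mono) auto
        finally show "\<bar>f (h (G \<omega>)) - f (h (G \<omega>)) * \<phi> \<eta> (G \<omega> 0)\<bar> \<le> B * (1 - \<phi> \<eta> (G \<omega> 0))" .
      qed (use G in \<open>auto intro!: integrable_mult_right\<close>)
      also have "\<dots> = B * (1 - (\<integral>\<omega>. \<phi> \<eta> (G \<omega> 0) \<partial>M))"
        using G by (simp add: prob_space)
      finally show ?thesis .
    qed
    show "(\<lambda>n. \<integral>\<omega>. f (h (U n \<omega>)) \<partial>M) \<longlonglongrightarrow> (\<integral>\<omega>. f (h (V \<omega>)) \<partial>M)"
    proof (rule tendstoI)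
      fix e :: real assume "0 < e"
      have "(\<lambda>k. \<integral>\<omega>. \<phi> (1 / real (Suc k)) (V \<omega> 0) \<partial>M) \<longlonglongrightarrow> (\<integral>\<omega>. 1 \<partial>M)"
      proof (rule integral_dominated_convergence[where w="\<lambda>_. 1"])
        show "AE \<omega> in M. (\<lambda>k. \<phi> (1 / real (Suc k)) (V \<omega> 0)) \<longlonglongrightarrow> 1"
          using nz
        proof (rule AE_mp, intro AE_I2 impI)
          fix \<omega> assume "V \<omega> 0 \<noteq> 0"
          then obtain k0 where k0: "1 / real (Suc k0) < \<bar>V \<omega> 0\<bar>"
            using reals_Archimedean[of "\<bar>V \<omega> 0\<bar>"] by (auto simp: inverse_eq_divide)
          have "\<phi> (1 / real (Suc k)) (V \<omega> 0) = 1" if "k0 \<le> k" for k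
          proof -
            have "1 / real (Suc k) \<le> 1 / real (Suc k0)" using that by (intro divide_left_mono) auto
            then have "1 / real (Suc k) < \<bar>V \<omega> 0\<bar>" using k0 by linarith
            then have "1 < \<bar>V \<omega> 0\<bar> * real (Suc k)" by (simp add: field_simps)
            then show ?thesis by (simp add: \<phi>_def)
          qed
          then have "eventually (\<lambda>k. \<phi> (1 / real (Suc k)) (V \<omega> 0) = 1) sequentially"
            by (auto simp: eventually_sequentially)
          then show "(\<lambda>k. \<phi> (1 / real (Suc k)) (V \<omega> 0)) \<longlonglongrightarrow> 1" by (rule tendsto_eventually)
        qed
      qed (use \<phi>01 in auto)
      then have "eventually (\<lambda>k. 1 - e / (4 * B) < (\<integral>\<omega>. \<phi> (1 / real (Suc k)) (V \<omega> 0) \<partial>M)) sequentially"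
        using \<open>0 < e\<close> B0 by (intro order_tendstoD) (auto simp: prob_space)
      then obtain k where k: "1 - e / (4 * B) < (\<integral>\<omega>. \<phi> (1 / real (Suc k)) (V \<omega> 0) \<partial>M)"
        by (auto simp: eventually_sequentially)
      define \<eta> where "\<eta> = 1 / real (Suc k)"
      have \<eta>: "0 < \<eta>" by (simp add: \<eta>_def)
      have c\<phi>: "continuous_on UNIV (\<lambda>x :: nat \<Rightarrow> real. \<phi> \<eta> (x 0))"
        unfolding \<phi>_def using \<eta> by (intro continuous_intros continuous_on_product_coordinates) auto
      have b\<phi>: "bounded (range (\<lambda>x :: nat \<Rightarrow> real. \<phi> \<eta> (x 0)))"
        using \<phi>01 by (auto simp: bounded_iff intro!: exI[of _ 1])
      have 1: "(\<lambda>n. \<integral>\<omega>. \<phi> \<eta> (U n \<omega> 0) \<partial>M) \<longlonglongrightarrow> (\<integral>\<omega>. \<phi> \<eta> (V \<omega> 0) \<partial>M)"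
        using conv c\<phi> b\<phi> unfolding conv_distr_def by blast
      have mx: "max ((x 0)\<^sup>2) ((\<eta> / 2)\<^sup>2) \<noteq> 0" for x :: "nat \<Rightarrow> real"
        using \<eta> less_le_trans[OF _ max.cobounded2, of 0 "(\<eta> / 2)\<^sup>2" "(x 0)\<^sup>2"] by simp
      have "continuous_on UNIV (\<lambda>x. H \<eta> x j)" for j
        unfolding H_def using mx by (cases "j < r") (auto intro!: continuous_intros continuous_on_product_coordinates)
      then have cH: "continuous_on UNIV (H \<eta>)" by (rule continuous_on_coordinatewise_then_product)
      have cF: "continuous_on UNIV (\<lambda>x. f (H \<eta> x) * \<phi> \<eta> (x 0))"
        by (intro continuous_on_mult c\<phi> continuous_on_compose2[OF f(1) cH]) auto
      have bF: "bounded (range (\<lambda>x. f (H \<eta> x) * \<phi> \<eta> (x 0)))"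
      proof -
        have "\<bar>f x * \<phi> \<eta> y\<bar> \<le> B * 1" for x y
          unfolding abs_mult using B[of x] \<phi>01[of \<eta> y] B0 by (intro mult_mono) auto
        then show ?thesis by (auto simp: bounded_iff)
      qed
      have Feq: "f (H \<eta> x) * \<phi> \<eta> (x 0) = f (h x) * \<phi> \<eta> (x 0)" for x
        using Hh[of \<eta> x] \<eta> by (cases "\<phi> \<eta> (x 0) = 0") auto
      have 2: "(\<lambda>n. \<integral>\<omega>. f (h (U n \<omega>)) * \<phi> \<eta> (U n \<omega> 0) \<partial>M) \<longlonglongrightarrow> (\<integral>\<omega>. f (h (V \<omega>)) * \<phi> \<eta> (V \<omega> 0) \<partial>M)"
        using conv cF bF unfolding conv_distr_def Feq by blast
      \<comment> \<open>The cutoff is itself a bounded continuous test function, so the smallness of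
        the mass of V near 0 passes to U n for large n. The final budget is e/4 for each cutoff and
        e/2 for the cut integrals.\<close>
      have "eventually (\<lambda>n. 1 - e / (4 * B) < (\<integral>\<omega>. \<phi> \<eta> (U n \<omega> 0) \<partial>M)) sequentially"
        using 1 k by (intro order_tendstoD) (auto simp: \<eta>_def)
      moreover have "eventually (\<lambda>n. dist (\<integral>\<omega>. f (h (U n \<omega>)) * \<phi> \<eta> (U n \<omega> 0) \<partial>M)
          (\<integral>\<omega>. f (h (V \<omega>)) * \<phi> \<eta> (V \<omega> 0) \<partial>M) < e / 2) sequentially"
        using 2 \<open>0 < e\<close> by (intro tendstoD) auto
      ultimately show "eventually (\<lambda>n. dist (\<integral>\<omega>. f (h (U n \<omega>)) \<partial>M) (\<integral>\<omega>. f (h (V \<omega>)) \<partial>M) < e) sequentially"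
      proof (rule eventually_elim2)
        fix n
        assume n: "1 - e / (4 * B) < (\<integral>\<omega>. \<phi> \<eta> (U n \<omega> 0) \<partial>M)"
          "dist (\<integral>\<omega>. f (h (U n \<omega>)) * \<phi> \<eta> (U n \<omega> 0) \<partial>M) (\<integral>\<omega>. f (h (V \<omega>)) * \<phi> \<eta> (V \<omega> 0) \<partial>M) < e / 2"
        have q: "B * (1 - z) < e / 4" if "1 - e / (4 * B) < z" for z
          using that B0 by (simp add: field_simps)
        show "dist (\<integral>\<omega>. f (h (U n \<omega>)) \<partial>M) (\<integral>\<omega>. f (h (V \<omega>)) \<partial>M) < e"
          using cut[of "U n" \<eta>, OF U] cut[of V \<eta>, OF V] q[OF n(1)] q[OF k[folded \<eta>_def]] n(2)
          unfolding dist_real_def by linarith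
      qed
    qed
  qed
  then show ?thesis unfolding h_def[abs_def] .
qed

section \<open>Sequences with finitely many active coordinates\<close>

text \<open>The product metric is a sum of truncated coordinate distances with weights 2^(-n).
  Bounding every one of them by the whole finite sum costs only the total weight 2 and avoids
  tracking how the coordinates are enumerated.\<close>

lemma dist_fun_le_sum:
  fixes x y :: "nat \<Rightarrow> real"
  assumes "\<And>j. r < j \<Longrightarrow> x j = y j"
  shows "dist x y \<le> 2 * (\<Sum>j\<le>r. min 1 \<bar>x j - y j\<bar>)"
proof -
  let ?s = "\<Sum>j\<le>r. min 1 \<bar>x j - y j\<bar>"
  have s: "min (dist (x i) (y i)) 1 \<le> ?s" for i
  proof (cases "i \<le> r")
    case True
    have "min (dist (x i) (y i)) 1 = (\<Sum>j\<in>{i}. min 1 \<bar>x j - y j\<bar>)" by (simp add: dist_real_def min.commute)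
    also have "\<dots> \<le> ?s" using True by (intro sum_mono2) auto
    finally show ?thesis .
  next
    case False
    then show ?thesis using assms[of i] by (auto intro!: sum_nonneg)
  qed
  have sm: "summable (\<lambda>n. (1 / 2) ^ n * ?s)"
    by (intro summable_mult2 summable_geometric) simp
  have "dist x y = (\<Sum>n. (1 / 2) ^ n * min (dist (x (from_nat n)) (y (from_nat n))) 1)"
    by (simp add: dist_fun_def)
  also have "\<dots> \<le> (\<Sum>n. (1 / 2) ^ n * ?s)"
    by (intro suminf_le mult_left_mono s sm summable_comparison_test'[of "\<lambda>n. (1/2)^n * ?s", OF sm])
       (auto intro!: mult_left_mono s)
  also have "\<dots> = 2 * ?s"
    by (subst suminf_mult2[symmetric]) (auto simp: suminf_geometric)
  finally show ?thesis .
qed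

lemma tendsto_fun_nat:
  fixes x :: "nat \<Rightarrow> nat \<Rightarrow> real"
  assumes "\<And>m j. r < j \<Longrightarrow> x m j = y j" and lim: "\<And>j. j \<le> r \<Longrightarrow> (\<lambda>m. x m j) \<longlonglongrightarrow> y j"
  shows "x \<longlonglongrightarrow> y"
proof (subst tendsto_dist_iff, rule tendsto_sandwich[of "\<lambda>_. 0"])
  have "(\<lambda>m. 2 * (\<Sum>j\<le>r. min 1 \<bar>x m j - y j\<bar>)) \<longlonglongrightarrow> 2 * (\<Sum>j\<le>r. min 1 \<bar>y j - y j\<bar>)"
    by (intro tendsto_intros lim) auto
  then show "(\<lambda>m. 2 * (\<Sum>j\<le>r. min 1 \<bar>x m j - y j\<bar>)) \<longlonglongrightarrow> 0" by simp
  show "eventually (\<lambda>m. dist (x m) y \<le> 2 * (\<Sum>j\<le>r. min 1 \<bar>x m j - y j\<bar>)) sequentially"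
    using assms by (intro always_eventually allI dist_fun_le_sum) auto
qed auto

subsection \<open>Convergence of the finite-dimensional distributions\<close>

text \<open>Summability of the weights makes the sums beyond lag m small whatever their upper end,
  which is the uniformity in n that the truncation at lag m requires.\<close>

lemma tail_const_sums_small:
  assumes "0 < \<alpha>" "a \<in> ell_alpha_log \<alpha>" "0 < e"
  shows "eventually (\<lambda>m. \<forall>n. tail_const \<alpha> * (\<Sum>k=m+1..n. log_weight \<alpha> (a k))
    + sqrt (tail_const \<alpha> * (\<Sum>k=m+1..n. log_weight \<alpha> (a k))) \<le> e) sequentially"
proof -
  \<comment> \<open>Once the weighted sum is at most q^2, its square root is at most q and q^2 \<le>
    q as well, so the two terms add up to at most e.\<close>
  define q where "q = min 1 (e / 2)"
  have q: "0 < q" "q \<le> 1" "q \<le> e / 2" using \<open>0 < e\<close> by (auto simp: q_def)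
  define T where "T = tail_const \<alpha> + 1"
  have T: "0 < T" using tail_const_nonneg[OF \<open>0 < \<alpha>\<close>] by (simp add: T_def)
  have "0 < q\<^sup>2 / T" using q T by simp
  then obtain m0 where m0: "\<And>m n. m0 \<le> m \<Longrightarrow> \<bar>\<Sum>k=m..<n. log_weight \<alpha> (a (Suc k))\<bar> < q\<^sup>2 / T"
    using summable_log_weight[OF assms(2)] unfolding summable_Cauchy real_norm_def by blast
  have "tail_const \<alpha> * (\<Sum>k=m+1..n. log_weight \<alpha> (a k))
    + sqrt (tail_const \<alpha> * (\<Sum>k=m+1..n. log_weight \<alpha> (a k))) \<le> e" if "m0 \<le> m" for m n
  proof -
    let ?s = "\<Sum>k=m+1..n. log_weight \<alpha> (a k)"
    have "?s = (\<Sum>k=m..<n. log_weight \<alpha> (a (Suc k)))"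
      using sum.atLeast_Suc_lessThan_Suc_shift[of "\<lambda>k. log_weight \<alpha> (a k)" m n]
      by (simp add: atLeastLessThanSuc_atLeastAtMost comp_def)
    then have s: "?s < q\<^sup>2 / T" using m0[OF that, of n] by simp
    have s0: "0 \<le> ?s" using log_weight_nonneg[OF \<open>0 < \<alpha>\<close>] by (intro sum_nonneg) auto
    have "tail_const \<alpha> * ?s \<le> T * ?s" using s0 by (intro mult_right_mono) (auto simp: T_def)
    also have "\<dots> \<le> T * (q\<^sup>2 / T)" using s T by (intro mult_left_mono) auto
    also have "\<dots> = q\<^sup>2" using T by simp
    finally have W: "tail_const \<alpha> * ?s \<le> q\<^sup>2" .
    then have "sqrt (tail_const \<alpha> * ?s) \<le> q" using q by (intro real_le_lsqrt) auto
    moreover have "q\<^sup>2 \<le> q" using q by (simp add: power2_eq_square mult_left_le)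
    ultimately show ?thesis using W q by linarith
  qed
  then show ?thesis by (auto simp: eventually_sequentially)
qed

lemma gamma_n_measurable:
  assumes [measurable]: "\<And>t. eps t \<in> borel_measurable M"
  shows "gamma_n eps n h \<in> borel_measurable M"
  unfolding gamma_n_def[abs_def] by measurable

lemma Y_of_measurable:
  assumes [measurable]: "\<And>k. Y k \<in> borel_measurable M"
  shows "Y_of Y a \<in> borel_measurable M"
  unfolding Y_of_def[abs_def] by measurable

text \<open>Since (n / log n)^(1/\<alpha>) = (n log n)^(-1/\<alpha>) n^(2/\<alpha>), the normalised
  statistic is exactly a quotient of coordinates of the joint vector. Where the denominator vanishes
  both sides are 0 by the division convention.\<close>

lemma Xt_n_eq_ratio:
  assumes "3 \<le> n"
  shows "Xt_n \<alpha> eps n a \<omega> = X_n \<alpha> eps n a \<omega> / (real n * gamma_n eps n 0 \<omega> / real n powr (2 / \<alpha>))"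
proof -
  have n: "0 < real n" "0 < ln (real n)" using assms by auto
  have "(real n / ln (real n)) powr (1 / \<alpha>) = real n powr (1 / \<alpha>) * ln (real n) powr (- 1 / \<alpha>)"
    using n by (simp add: powr_divide powr_minus_divide)
  also have "real n powr (1 / \<alpha>) = real n powr (- 1 / \<alpha>) * real n powr (2 / \<alpha>)"
    by (simp add: field_simps flip: powr_add)
  finally have c: "(real n / ln (real n)) powr (1 / \<alpha>)
      = (real n * ln (real n)) powr (- 1 / \<alpha>) * real n powr (2 / \<alpha>)"
    using n by (simp add: powr_mult mult_ac)
  have "(\<Sum>k=1..n-1. a k * rho_n eps n k \<omega>)
      = (\<Sum>k=1..n-1. a k * (real n * gamma_n eps n k \<omega>)) / (real n * gamma_n eps n 0 \<omega>)"
    using n by (simp add: rho_n_def sum_divide_distrib)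
  then show ?thesis unfolding Xt_n_def X_n_def c by simp
qed

theorem theorem3p1:
  fixes M :: "'w measure" and \<alpha> \<sigma>\<^sub>1 \<sigma>\<^sub>2 :: real
    and eps :: "int \<Rightarrow> 'w \<Rightarrow> real" and Y :: "nat \<Rightarrow> 'w \<Rightarrow> real"
  assumes "prob_space M"
    and "0 < \<alpha>" "\<alpha> < 2"
    and "prob_space.indep_vars M (\<lambda>_. borel) eps UNIV"
    and "\<And>t u. char (distr M borel (eps t)) u = exp (- complex_of_real (\<bar>u\<bar> powr \<alpha>))"
    and "0 < \<sigma>\<^sub>1" "0 < \<sigma>\<^sub>2"
    and "prob_space.indep_vars M (\<lambda>_. borel) Y UNIV"
    and "has_stable_law M (Y 0) (\<alpha> / 2) \<sigma>\<^sub>1 1 0"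
    and "\<And>k. k \<ge> 1 \<Longrightarrow> has_stable_law M (Y k) \<alpha> \<sigma>\<^sub>2 0 0"
    and "\<And>m. conv_distr M
           (\<lambda>n \<omega> h. if h = 0 then real n * gamma_n eps n 0 \<omega> / real n powr (2 / \<alpha>)
                     else if h \<le> m then real n * gamma_n eps n h \<omega> / (real n * ln (real n)) powr (1 / \<alpha>)
                     else 0)
           (\<lambda>\<omega> h. if h \<le> m then Y h \<omega> else 0)"
  shows "\<forall>(r::nat) (A :: nat \<Rightarrow> nat \<Rightarrow> real). (\<forall>j<r. A j \<in> ell_alpha_log \<alpha>) \<longrightarrow>
           conv_distr M (\<lambda>n \<omega> j. if j < r then X_n \<alpha> eps n (A j) \<omega> else 0)
                        (\<lambda>\<omega> j. if j < r then Y_of Y (A j) \<omega> else 0)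
         \<and> conv_distr M (\<lambda>n \<omega> j. if j < r then Xt_n \<alpha> eps n (A j) \<omega> else 0)
                        (\<lambda>\<omega> j. if j < r then Yt_of Y (A j) \<omega> else 0)"
proof (intro allI impI)
  fix r :: nat and A :: "nat \<Rightarrow> nat \<Rightarrow> real"
  assume A: "\<forall>j<r. A j \<in> ell_alpha_log \<alpha>"
  interpret prob_space M by fact
  note indep = assms(4) and char_eps = assms(5) and indep_Y = assms(8)
  have [measurable]: "eps t \<in> borel_measurable M" for t
    using indep by (auto simp: indep_vars_def)
  have [measurable]: "Y k \<in> borel_measurable M" for k
    using indep_Y by (auto simp: indep_vars_def)
  have [measurable]: "gamma_n eps n h \<in> borel_measurable M" for n h
    by (rule gamma_n_measurable) measurable
  have [measurable]: "X_n \<alpha> eps n a \<in> borel_measurable M" for n a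
    unfolding X_n_def[abs_def] by measurable
  have [measurable]: "Y_of Y a \<in> borel_measurable M" for a
    by (rule Y_of_measurable) measurable
  define Z where "Z m n \<omega> h = (if h = 0 then real n * gamma_n eps n 0 \<omega> / real n powr (2 / \<alpha>)
      else if h \<le> m then real n * gamma_n eps n h \<omega> / (real n * ln (real n)) powr (1 / \<alpha>)
      else 0)" for m n \<omega> and h :: nat
  \<comment> \<open>A continuous linear map from the vector of lags to the denominator, kept at
    coordinate 0, and the r truncated combinations, shifted to coordinates 1 to r.\<close>
  define \<Phi> where "\<Phi> m z h = (if h = 0 then z 0 else if h \<le> r then \<Sum>k=1..m. A (h - 1) k * z k else 0)"
    for m and z :: "nat \<Rightarrow> real" and h :: nat
  define J where "J n \<omega> h = (if h = 0 then real n * gamma_n eps n 0 \<omega> / real n powr (2 / \<alpha>)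
      else if h \<le> r then X_n \<alpha> eps n (A (h - 1)) \<omega> else 0)" for n \<omega> and h :: nat
  define JV where "JV \<omega> h = (if h = 0 then Y 0 \<omega> else if h \<le> r then Y_of Y (A (h - 1)) \<omega> else 0)"
    for \<omega> and h :: nat
  let ?Ym = "\<lambda>m \<omega> h. if h \<le> m then Y h \<omega> else 0"
  have Jm[measurable]: "(\<lambda>\<omega>. J n \<omega> h) \<in> borel_measurable M" for n h
    unfolding J_def by measurable
  have [measurable]: "(\<lambda>\<omega>. Z m n \<omega> h) \<in> borel_measurable M" for m n h
    unfolding Z_def by measurable
  have \<Phi>Z[measurable]: "(\<lambda>\<omega>. \<Phi> m (Z m n \<omega>) h) \<in> borel_measurable M" for m n h
    unfolding \<Phi>_def by measurable
  have \<Phi>Y[measurable]: "(\<lambda>\<omega>. \<Phi> m (?Ym m \<omega>) h) \<in> borel_measurable M" for m h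
    unfolding \<Phi>_def by measurable
  have JVm[measurable]: "(\<lambda>\<omega>. JV \<omega> h) \<in> borel_measurable M" for h
    unfolding JV_def by measurable
  have conv: "conv_distr M J JV"
  proof (rule conv_distr_approximation[where Um = "\<lambda>m n \<omega>. \<Phi> m (Z m n \<omega>)" and Vm = "\<lambda>m \<omega>. \<Phi> m (?Ym m \<omega>)"])
    show "J n \<in> borel_measurable M" for n by (rule measurable_coordinatewise_then_product) (rule Jm)
    show "JV \<in> borel_measurable M" by (rule measurable_coordinatewise_then_product) (rule JVm)
    show "(\<lambda>\<omega>. \<Phi> m (Z m n \<omega>)) \<in> borel_measurable M" for m n
      by (rule measurable_coordinatewise_then_product) (rule \<Phi>Z)
    show "(\<lambda>\<omega>. \<Phi> m (?Ym m \<omega>)) \<in> borel_measurable M" for m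
      by (rule measurable_coordinatewise_then_product) (rule \<Phi>Y)
    fix m
    have "continuous_on UNIV (\<lambda>z. \<Phi> m z h)" for h
      unfolding \<Phi>_def by (cases "h = 0"; cases "h \<le> r")
        (auto intro!: continuous_intros continuous_on_product_coordinates)
    then have "continuous_on UNIV (\<Phi> m)" by (rule continuous_on_coordinatewise_then_product)
    then show "conv_distr M (\<lambda>n \<omega>. \<Phi> m (Z m n \<omega>)) (\<lambda>\<omega>. \<Phi> m (?Ym m \<omega>))"
      unfolding Z_def by (rule conv_distr_continuous_map[OF assms(11)])
  next
    have "AE \<omega> in M. summable (\<lambda>k. A j (Suc k) * Y (Suc k) \<omega>)" if "j < r" for j
    proof -
      \<comment> \<open>The variable Y_0 has a different law and does not belong to the series; a
        zero coefficient hides it while the independent family stays indexed by all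
        naturals.\<close>
      let ?a = "\<lambda>k. if k = 0 then 0 else A j k"
      have "AE \<omega> in M. summable (\<lambda>k. ?a k * Y k \<omega>)"
      proof (rule AE_summable_stable[OF indep_Y \<open>0 < \<alpha>\<close>, of "\<sigma>\<^sub>2 powr \<alpha>"])
        fix k t assume "?a k \<noteq> 0"
        then have "1 \<le> k" by (cases k) auto
        then show "char (distr M borel (Y k)) t = exp (- complex_of_real (\<sigma>\<^sub>2 powr \<alpha> * \<bar>t\<bar> powr \<alpha>))"
          using assms(10)[of k] stable_charfun_symmetric[OF \<open>0 < \<sigma>\<^sub>2\<close>] by (simp add: has_stable_law_def)
      next
        have "summable (\<lambda>k. \<bar>A j (Suc k)\<bar> powr \<alpha>)"
          using A that by (simp add: ell_alpha_log_def)
        then have "summable (\<lambda>k. \<bar>?a (Suc k)\<bar> powr \<alpha>)" by simp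
        then show "summable (\<lambda>k. \<bar>?a k\<bar> powr \<alpha>)" by (subst (asm) summable_Suc_iff)
      qed simp
      then show ?thesis
        by (rule AE_mp, intro AE_I2 impI) (subst (asm) summable_Suc_iff[symmetric], simp)
    qed
    then have "AE \<omega> in M. \<forall>j\<in>{..<r}. summable (\<lambda>k. A j (Suc k) * Y (Suc k) \<omega>)"
      by (subst AE_ball_countable) auto
    then show "AE \<omega> in M. (\<lambda>m. \<Phi> m (?Ym m \<omega>)) \<longlonglongrightarrow> JV \<omega>"
    proof (rule AE_mp, intro AE_I2 impI)
      fix \<omega> assume sm: "\<forall>j\<in>{..<r}. summable (\<lambda>k. A j (Suc k) * Y (Suc k) \<omega>)"
      show "(\<lambda>m. \<Phi> m (?Ym m \<omega>)) \<longlonglongrightarrow> JV \<omega>"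
      proof (rule tendsto_fun_nat[of r])
        show "\<Phi> m (?Ym m \<omega>) h = JV \<omega> h" if "r < h" for m h
          using that by (simp add: \<Phi>_def JV_def)
        fix h assume "h \<le> r"
        show "(\<lambda>m. \<Phi> m (?Ym m \<omega>) h) \<longlonglongrightarrow> JV \<omega> h"
        proof (cases h)
          case 0
          then show ?thesis by (simp add: \<Phi>_def JV_def)
        next
          case (Suc j)
          have "(\<lambda>m. \<Sum>k<m. A j (Suc k) * Y (Suc k) \<omega>) \<longlonglongrightarrow> Y_of Y (A j) \<omega>"
            unfolding Y_of_def using sm Suc \<open>h \<le> r\<close> by (intro summable_LIMSEQ) auto
          moreover have "\<Phi> m (?Ym m \<omega>) h = (\<Sum>k<m. A j (Suc k) * Y (Suc k) \<omega>)" for m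
          proof -
            have "(\<Sum>k=1..m. A j k * ?Ym m \<omega> k) = (\<Sum>k=1..m. A j k * Y k \<omega>)" by (intro sum.cong) auto
            also have "\<dots> = (\<Sum>k<m. A j (Suc k) * Y (Suc k) \<omega>)"
              using sum.atLeast1_atMost_eq[of "\<lambda>k. A j k * Y k \<omega>" m] by simp
            finally show ?thesis using Suc \<open>h \<le> r\<close> by (simp add: \<Phi>_def)
          qed
          ultimately show ?thesis using Suc \<open>h \<le> r\<close> by (simp add: JV_def)
        qed
      qed
    qed
  next
    fix e :: real assume "0 < e"
    \<comment> \<open>One share for each of the r + 1 coordinates, halved for the factor 2 of the
      metric bound.\<close>
    define d where "d = e / (2 * real (Suc r))"
    have d: "0 < d" using \<open>0 < e\<close> by (simp add: d_def)
    let ?W = "\<lambda>j m n. tail_const \<alpha> * (\<Sum>k=m+1..n. log_weight \<alpha> (A j k))"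
    have "eventually (\<lambda>m. \<forall>j\<in>{..<r}. \<forall>n. ?W j m n + sqrt (?W j m n) \<le> d) sequentially"
      using A by (intro eventually_ball_finite) (auto intro!: tail_const_sums_small[OF \<open>0 < \<alpha>\<close> _ d, simplified])
    then obtain m0 where m0: "\<And>m j n. m0 \<le> m \<Longrightarrow> j < r \<Longrightarrow> ?W j m n + sqrt (?W j m n) \<le> d"
      by (auto simp: eventually_sequentially)
    have main: "(\<integral>\<omega>. min 1 (dist (J n \<omega>) (\<Phi> m (Z m n \<omega>))) \<partial>M) \<le> e"
      if "m0 \<le> m" "3 \<le> n" "m < n" for m n
    proof -
      let ?c = "(real n * ln (real n)) powr (- 1 / \<alpha>)"
      let ?d = "\<lambda>\<omega> h. J n \<omega> h - \<Phi> m (Z m n \<omega>) h"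
      have int[simp]: "integrable M (\<lambda>\<omega>. min 1 \<bar>?d \<omega> h\<bar>)" for h
        by (rule integrable_const_bound[where B=1]) auto
      have [measurable]: "J n \<in> borel_measurable M" "(\<lambda>\<omega>. \<Phi> m (Z m n \<omega>)) \<in> borel_measurable M"
        by (rule measurable_coordinatewise_then_product, measurable)+
      have term_le: "(\<integral>\<omega>. min 1 \<bar>?d \<omega> h\<bar> \<partial>M) \<le> d" if "h \<le> r" for h
      proof (cases h)
        case 0
        then show ?thesis using d by (simp add: J_def \<Phi>_def Z_def)
      next
        case (Suc j)
        have "?d \<omega> h = ?c * (\<Sum>k\<in>{m+1..n-1}. A j k * (real n * gamma_n eps n k \<omega>))" for \<omega>
        proof -
          \<comment> \<open>This splitting holds once n exceeds m, which is harmless because m is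
            fixed before n tends to infinity.\<close>
          have "{1..n-1} = {1..m} \<union> {m+1..n-1}" using \<open>m < n\<close> by auto
          then have "(\<Sum>k=1..n-1. A j k * (real n * gamma_n eps n k \<omega>))
            = (\<Sum>k=1..m. A j k * (real n * gamma_n eps n k \<omega>)) + (\<Sum>k\<in>{m+1..n-1}. A j k * (real n * gamma_n eps n k \<omega>))"
            by (simp add: sum.union_disjoint)
          moreover have "(\<Sum>k=1..m. A j k * Z m n \<omega> k) = ?c * (\<Sum>k=1..m. A j k * (real n * gamma_n eps n k \<omega>))"
            unfolding sum_distrib_left
            by (intro sum.cong) (auto simp: Z_def powr_minus divide_inverse mult_ac)
          ultimately show ?thesis
            using Suc \<open>h \<le> r\<close> by (simp add: J_def \<Phi>_def X_n_def distrib_left)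
        qed
        then have "(\<integral>\<omega>. min 1 \<bar>?d \<omega> h\<bar> \<partial>M)
          = (\<integral>\<omega>. min 1 \<bar>?c * (\<Sum>k\<in>{m+1..n-1}. A j k * (real n * gamma_n eps n k \<omega>))\<bar> \<partial>M)"
          by (simp only:)
        also have "\<dots> \<le> ?W j m (n - 1) + sqrt (?W j m (n - 1))"
          by (rule expectation_tail_le[OF \<open>0 < \<alpha>\<close> indep char_eps \<open>3 \<le> n\<close>]) auto
        also have "\<dots> \<le> d" using m0 \<open>m0 \<le> m\<close> Suc \<open>h \<le> r\<close> by simp
        finally show ?thesis .
      qed
      have "(\<integral>\<omega>. min 1 (dist (J n \<omega>) (\<Phi> m (Z m n \<omega>))) \<partial>M) \<le> (\<integral>\<omega>. 2 * (\<Sum>h\<le>r. min 1 \<bar>?d \<omega> h\<bar>) \<partial>M)"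
      proof (rule integral_mono)
        show "integrable M (\<lambda>\<omega>. min 1 (dist (J n \<omega>) (\<Phi> m (Z m n \<omega>))))"
          by (rule integrable_const_bound[where B=1]) auto
        fix \<omega>
        have "dist (J n \<omega>) (\<Phi> m (Z m n \<omega>)) \<le> 2 * (\<Sum>h\<le>r. min 1 \<bar>?d \<omega> h\<bar>)"
          by (rule dist_fun_le_sum) (simp add: J_def \<Phi>_def)
        then show "min 1 (dist (J n \<omega>) (\<Phi> m (Z m n \<omega>))) \<le> 2 * (\<Sum>h\<le>r. min 1 \<bar>?d \<omega> h\<bar>)" by simp
      qed (intro integrable_mult_right Bochner_Integration.integrable_sum int)
      also have "\<dots> = 2 * (\<Sum>h\<le>r. \<integral>\<omega>. min 1 \<bar>?d \<omega> h\<bar> \<partial>M)"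
        by (simp add: Bochner_Integration.integral_sum)
      also have "\<dots> \<le> 2 * (\<Sum>h\<le>r. d)" by (intro mult_left_mono sum_mono term_le) auto
      also have "\<dots> = e" by (simp add: d_def field_simps)
      finally show ?thesis .
    qed
    show "\<exists>m0. \<forall>m\<ge>m0. eventually (\<lambda>n. (\<integral>\<omega>. min 1 (dist (J n \<omega>) (\<Phi> m (Z m n \<omega>))) \<partial>M) \<le> e) sequentially"
    proof (intro exI[of _ m0] allI impI)
      fix m assume "m0 \<le> m"
      then show "eventually (\<lambda>n. (\<integral>\<omega>. min 1 (dist (J n \<omega>) (\<Phi> m (Z m n \<omega>))) \<partial>M) \<le> e) sequentially"
        using main[of m] unfolding eventually_sequentially by (intro exI[of _ "max 3 (Suc m)"]) auto
    qed
  qed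
  \<comment> \<open>Dropping the denominator is a continuous projection, so the first assertion is
    an image of the joint convergence.\<close>
  have "conv_distr M (\<lambda>n \<omega> j. if j < r then J n \<omega> (Suc j) else 0) (\<lambda>\<omega> j. if j < r then JV \<omega> (Suc j) else 0)"
  proof (rule conv_distr_continuous_map[OF conv, where g = "\<lambda>x j. if j < r then x (Suc j) else 0"])
    show "continuous_on UNIV (\<lambda>(x :: nat \<Rightarrow> real) j. if j < r then x (Suc j) else 0)"
    proof (rule continuous_on_coordinatewise_then_product)
      show "continuous_on UNIV (\<lambda>x :: nat \<Rightarrow> real. if j < r then x (Suc j) else 0)" for j
        by (cases "j < r") auto
    qed
  qed
  moreover have "(\<lambda>n \<omega> j. if j < r then J n \<omega> (Suc j) else 0) = (\<lambda>n \<omega> j. if j < r then X_n \<alpha> eps n (A j) \<omega> else 0)"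
    "(\<lambda>\<omega> j. if j < r then JV \<omega> (Suc j) else 0) = (\<lambda>\<omega> j. if j < r then Y_of Y (A j) \<omega> else 0)"
    by (auto simp: J_def JV_def fun_eq_iff)
  ultimately have "conv_distr M (\<lambda>n \<omega> j. if j < r then X_n \<alpha> eps n (A j) \<omega> else 0)
                        (\<lambda>\<omega> j. if j < r then Y_of Y (A j) \<omega> else 0)" by simp
  moreover have "conv_distr M (\<lambda>n \<omega> j. if j < r then Xt_n \<alpha> eps n (A j) \<omega> else 0)
                        (\<lambda>\<omega> j. if j < r then Yt_of Y (A j) \<omega> else 0)"
  proof (rule conv_distr_cong)
    have "prob {\<omega> \<in> space M. Y 0 \<omega> = 0} = 0"
    proof (rule prob_eq_0_of_char_decay[of _ "\<sigma>\<^sub>1 powr (\<alpha> / 2)" "\<alpha> / 2"])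
      fix t
      have "char (distr M borel (Y 0)) t = stable_charfun (\<alpha> / 2) \<sigma>\<^sub>1 1 0 t"
        using assms(9) by (simp add: has_stable_law_def)
      \<comment> \<open>The index \<alpha>/2 is below 1, so the case of index different from 1
        applies, and its skewness term in the exponent is purely imaginary and vanishes in the
        modulus.\<close>
      then show "norm (char (distr M borel (Y 0)) t) \<le> exp (- (\<sigma>\<^sub>1 powr (\<alpha> / 2) * \<bar>t\<bar> powr (\<alpha> / 2)))"
        using \<open>\<alpha> < 2\<close> by (simp add: stable_charfun_def)
    qed (use assms in auto)
    then have nz: "AE \<omega> in M. JV \<omega> 0 \<noteq> 0"
      by (subst (asm) prob_eq_0) (auto simp: JV_def)
    have eq: "(\<lambda>\<omega> j. if j < r then Yt_of Y (A j) \<omega> else 0) = (\<lambda>\<omega> j. if j < r then JV \<omega> (Suc j) / JV \<omega> 0 else 0)"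
      by (auto simp: JV_def Yt_of_def fun_eq_iff)
    show "conv_distr M (\<lambda>n \<omega> j. if j < r then J n \<omega> (Suc j) / J n \<omega> 0 else 0)
        (\<lambda>\<omega> j. if j < r then Yt_of Y (A j) \<omega> else 0)"
      unfolding eq by (rule conv_distr_ratio[OF Jm JVm conv nz])
    show "eventually (\<lambda>n. \<forall>\<omega>. (\<lambda>j. if j < r then J n \<omega> (Suc j) / J n \<omega> 0 else 0)
        = (\<lambda>j. if j < r then Xt_n \<alpha> eps n (A j) \<omega> else 0)) sequentially"
      using eventually_ge_at_top[of 3]
      by (rule eventually_mono) (auto simp: J_def Xt_n_eq_ratio fun_eq_iff)
  qed
  ultimately show "conv_distr M (\<lambda>n \<omega> j. if j < r then X_n \<alpha> eps n (A j) \<omega> else 0)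
                        (\<lambda>\<omega> j. if j < r then Y_of Y (A j) \<omega> else 0)
         \<and> conv_distr M (\<lambda>n \<omega> j. if j < r then Xt_n \<alpha> eps n (A j) \<omega> else 0)
                        (\<lambda>\<omega> j. if j < r then Yt_of Y (A j) \<omega> else 0)" by blast
qed

end
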